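(* Let $q$ be a prime power, $n\geq2$, $V=\mathbb F_q^{n+1}$, $1\neq\sigma\in\mathrm{Aut}(\mathbb F_q)$, and assume $n>2$ or $\sigma^2\neq1$. Let $M\in M_{n+1}(q)\setminus\{0\}$. Then $c_M$ is a minimum weight codeword of $\mathcal C(\Lambda_\sigma)$ if and only if $\bar\varepsilon_\sigma^{-1}([M^\perp])$ is a quasi-singular but not singular hyperplane of $\bar\Gamma$; and $c_M$ is a codeword of second lowest weight if and only if $\bar\varepsilon_\sigma^{-1}([M^\perp])$ is a singular hyperplane of $\bar\Gamma$.
   Context: $V$ consists of column vectors, $V^*$ of row vectors, $\xi(x)=\xi x$; $A^\sigma$ means $\sigma$ applied entrywise. $\bar\Gamma$ is the point-hyperplane geometry of $\mathrm{PG}(V)$: points are pairs $(p,H)$, $p$ a point and $H$ a hyperplane of $\mathrm{PG}(V)$ with $p\in H$; lines are $\{(p,H):p\in r\}$ ($r$ a line in $H$) and $\{(p,H):S\subseteq H\}$ ($S$ a codimension-2 subspace through $p$). The twisted embedding is $\bar\varepsilon_\sigma([x],[\xi])=[x^\sigma\xi]\in\mathrm{PG}(M_{n+1}(q))$, $\Lambda_\sigma$ its image with representatives $X_1,\dots,X_N$, $\mathcal C(\Lambda_\sigma)=\{c_M\}$, $c_M=(\mathrm{Tr}(X_1M),\dots,\mathrm{Tr}(X_NM))$, $M^\perp=\{X:\mathrm{Tr}(XM)=0\}$, so $\bar\varepsilon_\sigma^{-1}([M^\perp])=\{([x],[\xi])\in\bar\Gamma:\xi Mx^\sigma=0\}$.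 For a point $p$ and hyperplane $A$ of $\mathrm{PG}(V)$, the quasi-singular hyperplane $\mathcal H_{p,A}$ is the set of points of $\bar\Gamma$ equal or collinear to a point of $\{(p,H):p\in H\}\cup\{(x,A):x\in A\}$; it is called singular if $p\in A$. *)

theory Defs
  imports "HOL-Analysis.Analysis"
begin

section \<open>Field automorphisms\<close>

definition field_aut :: "('a::field \<Rightarrow> 'a) \<Rightarrow> bool" where
  "field_aut \<sigma> \<longleftrightarrow> bij \<sigma> \<and> \<sigma> 1 = 1 \<and>
     (\<forall>a b. \<sigma> (a + b) = \<sigma> a + \<sigma> b) \<and> (\<forall>a b. \<sigma> (a * b) = \<sigma> a * \<sigma> b)"

definition vec_twist :: "('a \<Rightarrow> 'a) \<Rightarrow> 'a^'n \<Rightarrow> 'a^'n" where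
  "vec_twist \<sigma> x = (\<chi> i. \<sigma> (x $ i))"

section \<open>The projective space of column vectors and its point-hyperplane geometry\<close>

text \<open>Points, lines, codimension-2 subspaces and hyperplanes of the projective space are
  identified with the corresponding linear subspaces of the vector space.  Dimensions are
  vector space dimensions.\<close>

definition pg_subspaces :: "nat \<Rightarrow> ('a::field^'n) set set" where
  "pg_subspaces d = {W. vec.subspace W \<and> vec.dim W = d}"

definition pg_points :: "('a::field^'n) set set" where
  "pg_points = pg_subspaces 1"

definition pg_lines :: "('a::field^'n) set set" where
  "pg_lines = pg_subspaces 2"

definition pg_colines :: "('a::field^'n) set set" where
  "pg_colines = pg_subspaces (CARD('n) - 2)"

definition pg_hyperplanes :: "('a::field^'n) set set" where
  "pg_hyperplanes = pg_subspaces (CARD('n) - 1)"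

type_synonym ('a, 'n) flag = "('a^'n) set \<times> ('a^'n) set"

definition flag_points :: "('a::field, 'n::finite) flag set" where
  "flag_points = {(p, H). p \<in> pg_points \<and> H \<in> pg_hyperplanes \<and> p \<subseteq> H}"

definition flag_lines :: "('a::field, 'n::finite) flag set set" where
  "flag_lines =
     {{(p, H) | p. p \<in> pg_points \<and> p \<subseteq> r} | r H.
        r \<in> pg_lines \<and> H \<in> pg_hyperplanes \<and> r \<subseteq> H} \<union>
     {{(p, H) | H. H \<in> pg_hyperplanes \<and> S \<subseteq> H} | p S.
        p \<in> pg_points \<and> S \<in> pg_colines \<and> p \<subseteq> S}"

definition flag_collinear :: "('a::field, 'n::finite) flag \<Rightarrow> ('a, 'n) flag \<Rightarrow> bool" where
  "flag_collinear P Q \<longleftrightarrow> (\<exists>L\<in>flag_lines. P \<in> L \<and> Q \<in> L)"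

definition qs_hyperplane :: "('a::field^'n::finite) set \<Rightarrow> ('a^'n) set \<Rightarrow> ('a, 'n) flag set" where
  "qs_hyperplane p A =
     {P \<in> flag_points.
        \<exists>Q \<in> {(p, H) | H. H \<in> pg_hyperplanes \<and> p \<subseteq> H} \<union> {(x, A) | x. x \<in> pg_points \<and> x \<subseteq> A}.
          P = Q \<or> flag_collinear P Q}"

definition quasi_singular :: "('a::field, 'n::finite) flag set \<Rightarrow> bool" where
  "quasi_singular S \<longleftrightarrow> (\<exists>p\<in>pg_points. \<exists>A\<in>pg_hyperplanes. S = qs_hyperplane p A)"

definition singular :: "('a::field, 'n::finite) flag set \<Rightarrow> bool" where
  "singular S \<longleftrightarrow> (\<exists>p\<in>pg_points. \<exists>A\<in>pg_hyperplanes. p \<subseteq> A \<and> S = qs_hyperplane p A)"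

section \<open>The twisted embedding\<close>

definition col_class :: "'a::field^'n \<Rightarrow> ('a^'n) set" where
  "col_class x = vec.span {x}"

text \<open>The class of a nonzero row vector is identified with the hyperplane it annihilates.\<close>

definition row_class :: "'a::field^'n \<Rightarrow> ('a^'n) set" where
  "row_class \<xi> = {x. (rowvector \<xi> :: 'a^'n^1) *v x = 0}"

definition mat_class :: "'a::field^'n^'n \<Rightarrow> ('a^'n^'n) set" where
  "mat_class X = {map_matrix ((*) c) X | c. True}"

definition pg_mat :: "('a::field^'n^'n) set \<Rightarrow> ('a^'n^'n) set set" where
  "pg_mat W = {mat_class X | X. X \<in> W \<and> X \<noteq> 0}"

definition twisted_mat :: "('a::field \<Rightarrow> 'a) \<Rightarrow> 'a^'n \<Rightarrow> 'a^'n \<Rightarrow> 'a^'n^'n" where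
  "twisted_mat \<sigma> x \<xi> = (columnvector (vec_twist \<sigma> x) :: 'a^1^'n) ** (rowvector \<xi> :: 'a^'n^1)"

text \<open>The description is independent of the representatives, see
  \<open>twisted_embedding_class\<close> below.\<close>

definition twisted_embedding ::
    "('a::field \<Rightarrow> 'a) \<Rightarrow> ('a, 'n::finite) flag \<Rightarrow> ('a^'n^'n) set" where
  "twisted_embedding \<sigma> P = (THE E. \<exists>x \<xi>. x \<noteq> 0 \<and> \<xi> \<noteq> 0 \<and>
     P = (col_class x, row_class \<xi>) \<and> E = mat_class (twisted_mat \<sigma> x \<xi>))"

definition twisted_image :: "('a::field \<Rightarrow> 'a) \<Rightarrow> ('a^'n^'n) set set" where
  "twisted_image \<sigma> = twisted_embedding \<sigma> ` flag_points"

definition mat_perp :: "'a::field^'n^'n \<Rightarrow> ('a^'n^'n) set" where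
  "mat_perp M = {X. trace (X ** M) = 0}"

definition twisted_preimage ::
    "('a::field \<Rightarrow> 'a) \<Rightarrow> ('a^'n^'n) set set \<Rightarrow> ('a, 'n::finite) flag set" where
  "twisted_preimage \<sigma> \<P> = {P \<in> flag_points. twisted_embedding \<sigma> P \<in> \<P>}"

lemma twisted_mat_nth: "twisted_mat \<sigma> x \<xi> $ i $ j = \<sigma> (x $ i) * \<xi> $ j"
  by (simp add: twisted_mat_def vec_twist_def columnvector_def rowvector_def
      matrix_matrix_mult_def)

lemma row_class_iff: "x \<in> row_class \<xi> \<longleftrightarrow> (\<Sum>i\<in>UNIV. \<xi> $ i * x $ i) = 0"
  by (simp add: row_class_def rowvector_def matrix_vector_mult_def vec_eq_iff)

lemma row_class_eqD:
  fixes \<xi> \<eta> :: "'a::field^'n"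
  assumes "\<xi> \<noteq> 0" "\<eta> \<noteq> 0" and eq: "row_class \<xi> = row_class \<eta>"
  shows "\<exists>d. d \<noteq> 0 \<and> \<eta> = d *s \<xi>"
proof -
  obtain i where i: "\<xi> $ i \<noteq> 0" using \<open>\<xi> \<noteq> 0\<close> by (auto simp: vec_eq_iff)
  have sum2: "(\<Sum>k\<in>UNIV. \<zeta> $ k * (\<chi> k. (if k = j then a else 0) - (if k = i then b else 0)) $ k)
      = \<zeta> $ j * a - \<zeta> $ i * b" for \<zeta> :: "'a^'n" and j a b
    by (simp add: right_diff_distrib sum_subtractf if_distrib[where f = "(*) _"] cong: if_cong)
  have "\<xi> $ i * \<eta> $ j = \<xi> $ j * \<eta> $ i" for j
  proof -
    let ?v = "\<chi> k. (if k = j then \<xi> $ i else 0) - (if k = i then \<xi> $ j else 0)"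
    have "?v \<in> row_class \<xi>" unfolding row_class_iff sum2 by simp
    then have "?v \<in> row_class \<eta>" using eq by simp
    then have "\<eta> $ j * \<xi> $ i - \<eta> $ i * \<xi> $ j = 0" unfolding row_class_iff sum2 .
    then show ?thesis by (simp add: mult.commute)
  qed
  then have *: "\<eta> = (\<eta> $ i / \<xi> $ i) *s \<xi>" using i by (simp add: vec_eq_iff field_simps)
  moreover have "\<eta> $ i / \<xi> $ i \<noteq> 0" using * \<open>\<eta> \<noteq> 0\<close> by (metis vector_smult_lzero)
  ultimately show ?thesis by blast
qed

lemma col_class_eqD:
  fixes x y :: "'a::field^'n"
  assumes "y \<noteq> 0" "col_class x = col_class y"
  shows "\<exists>c. c \<noteq> 0 \<and> y = c *s x"
proof -
  have "y \<in> vec.span {x}" using assms vec.span_base[of y "{y}"] by (simp add: col_class_def)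
  then obtain c where c: "y = c *s x" by (auto simp: vec.span_singleton)
  then show ?thesis using \<open>y \<noteq> 0\<close> by (metis vector_smult_lzero)
qed

lemma mat_class_scale:
  assumes "c \<noteq> 0"
  shows "mat_class (map_matrix ((*) c) X) = mat_class X"
proof -
  have "map_matrix ((*) a) X = map_matrix ((*) (a / c)) (map_matrix ((*) c) X)" for a
    using assms by (simp add: map_matrix_def vec_eq_iff)
  moreover have "map_matrix ((*) a) (map_matrix ((*) c) X) = map_matrix ((*) (a * c)) X" for a
    by (simp add: map_matrix_def vec_eq_iff mult.assoc)
  ultimately show ?thesis unfolding mat_class_def by blast
qed

lemma twisted_embedding_class:
  assumes \<sigma>: "field_aut \<sigma>" and nz: "x \<noteq> 0" "\<xi> \<noteq> 0"
  shows "twisted_embedding \<sigma> (col_class x, row_class \<xi>) = mat_class (twisted_mat \<sigma> x \<xi>)"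
  unfolding twisted_embedding_def
proof (rule the_equality)
  show "\<exists>y \<eta>. y \<noteq> 0 \<and> \<eta> \<noteq> 0 \<and> (col_class x, row_class \<xi>) = (col_class y, row_class \<eta>) \<and>
      mat_class (twisted_mat \<sigma> x \<xi>) = mat_class (twisted_mat \<sigma> y \<eta>)"
    using nz by blast
next
  fix E
  assume "\<exists>y \<eta>. y \<noteq> 0 \<and> \<eta> \<noteq> 0 \<and> (col_class x, row_class \<xi>) = (col_class y, row_class \<eta>) \<and>
      E = mat_class (twisted_mat \<sigma> y \<eta>)"
  then obtain y \<eta> where y: "y \<noteq> 0" "\<eta> \<noteq> 0" "col_class x = col_class y"
      "row_class \<xi> = row_class \<eta>" and E: "E = mat_class (twisted_mat \<sigma> y \<eta>)" by blast
  obtain c where c: "c \<noteq> 0" "y = c *s x" using col_class_eqD y by blast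
  obtain d where d: "d \<noteq> 0" "\<eta> = d *s \<xi>" using row_class_eqD y nz by blast
  have mult: "\<sigma> (a * b) = \<sigma> a * \<sigma> b" for a b using \<sigma> by (simp add: field_aut_def)
  have "\<sigma> c * \<sigma> (inverse c) = 1" using mult[of c "inverse c"] c \<sigma> by (simp add: field_aut_def)
  then have "\<sigma> c * d \<noteq> 0" using d by auto
  moreover have "twisted_mat \<sigma> y \<eta> = map_matrix ((*) (\<sigma> c * d)) (twisted_mat \<sigma> x \<xi>)"
    by (simp add: vec_eq_iff twisted_mat_nth c d mult)
  ultimately show "E = mat_class (twisted_mat \<sigma> x \<xi>)" using E mat_class_scale by metis
qed

section \<open>Linear codes\<close>

definition hamming_weight :: "'a::zero list \<Rightarrow> nat" where
  "hamming_weight c = card {i. i < length c \<and> c ! i \<noteq> 0}"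

definition min_weight_codeword :: "'a::zero list set \<Rightarrow> 'a list \<Rightarrow> bool" where
  "min_weight_codeword C c \<longleftrightarrow>
     c \<in> C \<and> hamming_weight c \<noteq> 0 \<and>
     (\<forall>d\<in>C. hamming_weight d \<noteq> 0 \<longrightarrow> hamming_weight c \<le> hamming_weight d)"

text \<open>The second lowest weight is the smallest weight strictly above the minimum weight of
  the nonzero codewords.\<close>

definition second_weight_codeword :: "'a::zero list set \<Rightarrow> 'a list \<Rightarrow> bool" where
  "second_weight_codeword C c \<longleftrightarrow>
     c \<in> C \<and> hamming_weight c \<noteq> 0 \<and> \<not> min_weight_codeword C c \<and>
     (\<forall>d\<in>C. hamming_weight d \<noteq> 0 \<and> \<not> min_weight_codeword C d \<longrightarrow>
        hamming_weight c \<le> hamming_weight d)"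

text \<open>A list of matrices containing exactly one representative of each element of a
  projective system.\<close>

definition representatives :: "('a::field^'n^'n) set set \<Rightarrow> ('a^'n^'n) list \<Rightarrow> bool" where
  "representatives \<Lambda> Xs \<longleftrightarrow> distinct (map mat_class Xs) \<and> mat_class ` set Xs = \<Lambda>"

definition codeword :: "('a::field^'n^'n) list \<Rightarrow> 'a^'n^'n \<Rightarrow> 'a list" where
  "codeword Xs M = map (\<lambda>X. trace (X ** M)) Xs"

definition proj_code :: "('a::field^'n^'n) list \<Rightarrow> 'a list set" where
  "proj_code Xs = range (codeword Xs)"

end

theory Submission
  imports Defs
begin

text \<open>For a nonzero \<open>x\<close>, the number of \<open>\<xi>\<close> with \<open>\<xi> x = 0\<close> and \<open>\<xi> M x\<^sup>\<sigma> \<noteq> 0\<close> is zero if \<open>x\<close> is an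
  eigenvector of the semilinear map \<open>f x = M x\<^sup>\<sigma>\<close>, and a positive constant otherwise.  So the
  weight of \<open>c\<^sub>M\<close> is a strictly decreasing function of the number of eigenvectors of \<open>f\<close>.  If \<open>f\<close>
  has rank one, \<open>f x = (\<beta> x)\<^sup>\<sigma> u\<close>, the eigenvectors are those of the hyperplane \<open>\<beta> x = 0\<close> together
  with the multiples of \<open>u\<close>, and the geometric hyperplane of \<open>M\<close> is the quasi-singular hyperplane of
  \<open>[u]\<close> and \<open>[\<beta>]\<close>.  In rank at least two there are fewer than \<open>q\<^sup>n\<close> eigenvectors: in a basis of
  \<open>m\<close> eigenvectors with nonzero eigenvalues, each nonzero eigenvalue has at most \<open>q\<^sub>0\<^sup>m\<close>
  eigenvectors, where \<open>q\<^sub>0\<close> is the order of the fixed field of \<open>\<sigma>\<close>.  Here \<open>q\<^sub>0\<^sup>2 \<le> q\<close>, and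
  \<open>q\<^sub>0\<^sup>3 \<le> q\<close> if \<open>\<sigma>\<^sup>2 \<noteq> 1\<close>, which settles the case \<open>n = 2\<close>.\<close>

section \<open>Points, hyperplanes and flags\<close>

text \<open>The product of a row and a column as a symmetric bilinear form on \<open>'a^'n\<close>,
  so that vectors and functionals can exchange roles.\<close>

definition dotp :: "'a::field^'n \<Rightarrow> 'a^'n \<Rightarrow> 'a" where
  "dotp \<xi> x = (\<Sum>i\<in>UNIV. \<xi> $ i * x $ i)"

lemma in_row_class: "x \<in> row_class \<xi> \<longleftrightarrow> dotp \<xi> x = 0"
  by (simp add: row_class_iff dotp_def)

lemma dotp_simps [simp]:
  "dotp \<xi> 0 = 0" "dotp 0 x = 0"
  "dotp \<xi> (x + y) = dotp \<xi> x + dotp \<xi> y" "dotp \<xi> (x - y) = dotp \<xi> x - dotp \<xi> y"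
  "dotp \<xi> (c *s x) = c * dotp \<xi> x"
  "dotp (\<xi> + \<eta>) x = dotp \<xi> x + dotp \<eta> x" "dotp (\<xi> - \<eta>) x = dotp \<xi> x - dotp \<eta> x"
  "dotp (c *s \<xi>) x = c * dotp \<xi> x"
  by (simp_all add: dotp_def algebra_simps sum.distrib sum_subtractf sum_distrib_left)

lemma dotp_commute: "dotp x y = dotp y x"
  by (simp add: dotp_def mult.commute)

lemma dotp_axis [simp]:
  "dotp \<xi> (axis i 1) = \<xi> $ i" "dotp (axis i 1) x = x $ i"
  by (simp_all add: dotp_def axis_def if_distrib[where f = "(*) _"] if_distrib[where f = "\<lambda>a. a * _"] cong: if_cong)

lemma subspace_row_class: "vec.subspace (row_class \<xi>)"
  unfolding row_class_def by (rule vec.subspace_kernel)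

lemma dotp_separates:
  assumes "\<xi> \<noteq> 0"
  obtains x where "dotp \<xi> x = 1"
proof -
  obtain i where "\<xi> $ i \<noteq> 0" using assms by (auto simp: vec_eq_iff)
  then have "dotp \<xi> ((1 / \<xi> $ i) *s axis i 1) = 1" by simp
  then show ?thesis using that by blast
qed

text \<open>A vector with \<open>dotp \<xi> x = 1\<close> complements the kernel: every
  \<open>y\<close> differs from \<open>dotp \<xi> y *s x\<close> by an element of
  \<open>row_class \<xi>\<close>.\<close>

lemma dim_row_class:
  fixes \<xi> :: "'a::field^'n"
  assumes "\<xi> \<noteq> 0"
  shows "vec.dim (row_class \<xi>) = CARD('n) - 1"
proof -
  obtain x where x: "dotp \<xi> x = 1" using dotp_separates assms by blast
  have "y \<in> vec.span (insert x (row_class \<xi>))" for y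
    unfolding vec.span_breakdown_eq
    using x by (intro exI[of _ "dotp \<xi> y"]) (simp add: in_row_class vec.span_base)
  then have "vec.span (insert x (row_class \<xi>)) = UNIV" by blast
  then have "vec.dim (insert x (row_class \<xi>)) = CARD('n)"
    by (metis vec.dim_span vec_dim_card)
  moreover have "x \<notin> vec.span (row_class \<xi>)"
    using x by (simp add: vec.span_eq_iff[THEN iffD2, OF subspace_row_class] in_row_class)
  ultimately show ?thesis by (simp add: vec.dim_insert)
qed

lemma hyperplane_row_class:
  "pg_hyperplanes = {row_class (\<xi> :: 'a::field^'n) | \<xi>. \<xi> \<noteq> 0}"
proof (intro equalityI subsetI)
  fix H :: "('a^'n) set"
  assume "H \<in> pg_hyperplanes"
  then have H: "vec.subspace H" "vec.dim H = CARD('n) - 1"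
    by (auto simp: pg_hyperplanes_def pg_subspaces_def)
  then obtain B where B: "B \<subseteq> H" "vec.independent B" "vec.span B = H"
    using vec.basis_subspace_exists by metis
  have "H \<noteq> UNIV"
  proof
    assume "H = UNIV"
    then have "CARD('n) = CARD('n) - 1" using H(2) vec_dim_card[where 'a = 'a and 'n = 'n] by metis
    then show False using zero_less_card_finite[where 'a = 'n] by linarith
  qed
  then obtain b where b: "b \<notin> vec.span B" using B(3) by blast
  then have ind: "vec.independent (insert b B)" using B(2) by (simp add: vec.independent_insert)
  \<comment> \<open>A functional vanishing on \<open>B\<close> but not at \<open>b\<close> is
    obtained as coordinate \<open>j\<close> of an endomorphism that kills \<open>B\<close> and sends
    \<open>b\<close> to a unit vector; row \<open>j\<close> of its matrix serves as
    \<open>\<xi>\<close>.\<close>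
  obtain j :: 'n where True by blast
  obtain g :: "'a^'n \<Rightarrow> 'a^'n" where g: "Vector_Spaces.linear (*s) (*s) g"
      "\<forall>x\<in>insert b B. g x = (if x = b then axis j 1 else (0 :: 'a^'n))"
    using vec.linear_independent_extend[OF ind, of "\<lambda>x. if x = b then axis j 1 else 0"] by blast
  define \<xi> where "\<xi> = (matrix g) $ j"
  have gj: "g x $ j = dotp \<xi> x" for x
    using matrix_works[OF g(1), of x]
    by (auto simp: \<xi>_def dotp_def matrix_vector_mult_def vec_eq_iff)
  have "B \<subseteq> row_class \<xi>"
    using g(2) b vec.span_base by (force simp: in_row_class gj[symmetric])
  then have "H \<subseteq> row_class \<xi>"
    using B(3) vec.span_minimal subspace_row_class by metis
  moreover have nz: "\<xi> \<noteq> 0" using g(2) gj[of b] by (auto simp: axis_def)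
  ultimately have "H = row_class \<xi>"
    using H by (intro vec.subspace_dim_equal) (simp_all add: subspace_row_class dim_row_class)
  then show "H \<in> {row_class \<xi> | \<xi>. \<xi> \<noteq> 0}" using nz by blast
next
  fix H :: "('a^'n) set"
  assume "H \<in> {row_class \<xi> | \<xi>. \<xi> \<noteq> 0}"
  then show "H \<in> pg_hyperplanes"
    by (auto simp: pg_hyperplanes_def pg_subspaces_def subspace_row_class dim_row_class)
qed

lemma points_col_class:
  "pg_points = {col_class (x :: 'a::field^'n) | x. x \<noteq> 0}"
proof (intro equalityI subsetI)
  fix p :: "('a^'n) set"
  assume "p \<in> pg_points"
  then obtain B where B: "vec.span B = p" "card B = 1" "vec.independent B"
    by (auto simp: pg_points_def pg_subspaces_def elim: vec.basis_subspace_exists)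
  then obtain x where "B = {x}" by (auto simp: card_1_singleton_iff)
  then show "p \<in> {col_class x | x. x \<noteq> 0}"
    using B vec.dependent_zero[of B] by (auto simp: col_class_def)
next
  fix p :: "('a^'n) set"
  assume "p \<in> {col_class x | x. x \<noteq> 0}"
  then show "p \<in> pg_points"
    by (auto simp: pg_points_def pg_subspaces_def col_class_def)
qed

lemma col_class_subset:
  assumes "vec.subspace W"
  shows "col_class x \<subseteq> W \<longleftrightarrow> x \<in> W"
  unfolding col_class_def
proof
  show "x \<in> W" if "vec.span {x} \<subseteq> W" using that vec.span_base[of x "{x}"] by blast
  show "vec.span {x} \<subseteq> W" if "x \<in> W" using that assms by (intro vec.span_minimal) simp_all
qed

lemma col_subset_row: "col_class x \<subseteq> row_class \<xi> \<longleftrightarrow> dotp \<xi> x = 0"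
  by (simp add: col_class_subset subspace_row_class in_row_class)

lemma flag_points_eq:
  "flag_points = {(col_class (x :: 'a::field^'n::finite), row_class \<xi>) | x \<xi>. x \<noteq> 0 \<and> \<xi> \<noteq> 0 \<and> dotp \<xi> x = 0}"
proof -
  have "(p, H) \<in> flag_points \<longleftrightarrow>
      (\<exists>x \<xi>. (p, H) = (col_class x, row_class \<xi>) \<and> x \<noteq> 0 \<and> \<xi> \<noteq> 0 \<and> dotp \<xi> x = 0)"
    for p H :: "('a^'n) set"
  proof -
    have "(p, H) \<in> flag_points \<longleftrightarrow>
        (\<exists>x \<xi>. (p, H) = (col_class x, row_class \<xi>) \<and> x \<noteq> 0 \<and> \<xi> \<noteq> 0 \<and> col_class x \<subseteq> row_class \<xi>)"
      unfolding flag_points_def points_col_class hyperplane_row_class by blast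
    then show ?thesis by (simp only: col_subset_row)
  qed
  then show ?thesis by (auto simp: set_eq_iff)
qed

lemma vec_dim_le_card: "vec.dim (W :: ('a::field^'n) set) \<le> CARD('n)"
  using vec.dim_subset[of W UNIV] unfolding vec_dim_card by simp

text \<open>The dimension formula for sums gives at least \<open>CARD('n) - 2\<close>; one dimension
  more would force \<open>A = A \<inter> H = H\<close>.\<close>

lemma dim_hyperplane_Int:
  fixes A H :: "('a::field^'n) set"
  assumes "A \<in> pg_hyperplanes" "H \<in> pg_hyperplanes" "A \<noteq> H"
  shows "vec.dim (A \<inter> H) = CARD('n) - 2"
proof -
  have sH: "vec.subspace H" and dH: "vec.dim H = CARD('n) - 1"
    and sA: "vec.subspace A" and dA: "vec.dim A = CARD('n) - 1"
    using assms by (auto simp: pg_hyperplanes_def pg_subspaces_def)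
  have sS: "vec.subspace (A \<inter> H)" using sA sH by (rule vec.subspace_inter)
  have "vec.dim {a + b | a b. a \<in> A \<and> b \<in> H} \<le> CARD('n)"
    by (rule vec_dim_le_card)
  then have "CARD('n) + vec.dim (A \<inter> H) \<ge> (CARD('n) - 1) + (CARD('n) - 1)"
    using vec.dim_sums_Int[OF sA sH] dA dH by linarith
  moreover have "vec.dim (A \<inter> H) < CARD('n) - 1"
  proof (rule ccontr)
    assume "\<not> vec.dim (A \<inter> H) < CARD('n) - 1"
    then have "A \<inter> H = A" "A \<inter> H = H"
      using dA dH by (intro vec.subspace_dim_equal sA sH sS; simp)+
    then show False using assms(3) by blast
  qed
  ultimately show ?thesis by linarith
qed

text \<open>Collinear flags share their point or their hyperplane, which gives one inclusion.
  Conversely, apart from equal flags, if \<open>p \<subseteq> H\<close> then \<open>(x, H)\<close>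
  and \<open>(p, H)\<close> lie on the line given by the join of \<open>x\<close> and
  \<open>p\<close> in \<open>H\<close>; if \<open>x \<subseteq> A\<close> then \<open>(x, H)\<close>
  and \<open>(x, A)\<close> lie on the line given by \<open>x\<close> and the hyperplanes through
  \<open>A \<inter> H\<close>.\<close>

lemma qs_hyperplane_eq:
  fixes p A :: "('a::field^'n) set"
  assumes p: "p \<in> pg_points" and A: "A \<in> pg_hyperplanes"
  shows "qs_hyperplane p A = {(x, H) \<in> flag_points. p \<subseteq> H \<or> x \<subseteq> A}" (is "?L = ?R")
proof (intro equalityI subsetI)
  fix P assume "P \<in> ?L"
  then have P: "P \<in> flag_points"
    and "\<exists>Q \<in> {(p, H) | H. H \<in> pg_hyperplanes \<and> p \<subseteq> H} \<union> {(x, A) | x. x \<in> pg_points \<and> x \<subseteq> A}.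
        P = Q \<or> flag_collinear P Q"
    unfolding qs_hyperplane_def by simp_all
  then obtain Q where "Q \<in> {(p, H) | H. H \<in> pg_hyperplanes \<and> p \<subseteq> H} \<union> {(x, A) | x. x \<in> pg_points \<and> x \<subseteq> A}"
    and PQ: "P = Q \<or> flag_collinear P Q" by (elim bexE)
  then have Q: "(\<exists>H. Q = (p, H) \<and> p \<subseteq> H) \<or> (\<exists>x. Q = (x, A) \<and> x \<subseteq> A)" by auto
  have "fst P = fst Q \<or> snd P = snd Q"
    using PQ
  proof
    assume "flag_collinear P Q"
    then obtain L where L: "L \<in> flag_lines" "P \<in> L" "Q \<in> L" unfolding flag_collinear_def by blast
    then consider r H where "L = {(p, H) | p. p \<in> pg_points \<and> p \<subseteq> r}"
      | p S where "L = {(p, H) | H. H \<in> pg_hyperplanes \<and> S \<subseteq> H}"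
      unfolding flag_lines_def by blast
    then show ?thesis using L(2,3) by cases auto
  qed simp
  moreover have "fst P \<subseteq> snd P" using P by (auto simp: flag_points_def)
  ultimately have "p \<subseteq> snd P \<or> fst P \<subseteq> A" using Q by auto
  then show "P \<in> ?R" using P by (simp add: case_prod_beta)
next
  fix P assume P: "P \<in> ?R"
  obtain x H where xH: "P = (x, H)" by (cases P)
  have x: "x \<in> pg_points" and H: "H \<in> pg_hyperplanes" and sub: "x \<subseteq> H"
    and alt: "p \<subseteq> H \<or> x \<subseteq> A" and fl: "P \<in> flag_points"
    using P by (auto simp: xH flag_points_def)
  have sH: "vec.subspace H" and sA: "vec.subspace A"
    using H A by (auto simp: pg_hyperplanes_def pg_subspaces_def)
  have sx: "vec.subspace x" and dx: "vec.dim x = 1" and sp: "vec.subspace p" and dp: "vec.dim p = 1"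
    using x p by (auto simp: pg_points_def pg_subspaces_def)
  have L: "P \<in> ?L" if "P = Q \<or> flag_collinear P Q"
    "Q \<in> {(p, H) | H. H \<in> pg_hyperplanes \<and> p \<subseteq> H} \<union> {(x, A) | x. x \<in> pg_points \<and> x \<subseteq> A}" for Q
  proof -
    have "\<exists>Q \<in> {(p, H) | H. H \<in> pg_hyperplanes \<and> p \<subseteq> H} \<union> {(x, A) | x. x \<in> pg_points \<and> x \<subseteq> A}.
        P = Q \<or> flag_collinear P Q" using that by (rule bexI)
    then show ?thesis unfolding qs_hyperplane_def using fl by (intro CollectI conjI)
  qed
  show "P \<in> ?L"
  proof (cases "p \<subseteq> H")
    case True
    have "P = (p, H) \<or> flag_collinear P (p, H)"
    proof (cases "x = p")
      case False
      define r where "r = {a + b | a b. a \<in> x \<and> b \<in> p}"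
      have "vec.dim (x \<inter> p) = 0"
      proof (rule ccontr)
        assume "vec.dim (x \<inter> p) \<noteq> 0"
        then have "vec.dim (x \<inter> p) \<ge> 1" by linarith
        then have "x \<inter> p = x" "x \<inter> p = p"
          using dx dp sx sp by (intro vec.subspace_dim_equal vec.subspace_inter; simp)+
        then show False using False by blast
      qed
      then have "vec.dim r = 2" using vec.dim_sums_Int[OF sx sp] dx dp unfolding r_def by linarith
      moreover have "vec.subspace r" unfolding r_def by (rule vec.subspace_sums[OF sx sp])
      ultimately have "r \<in> pg_lines" by (simp add: pg_lines_def pg_subspaces_def)
      moreover have "r \<subseteq> H" using vec.subspace_add[OF sH] sub True by (auto simp: r_def)
      moreover have "x \<subseteq> r" "p \<subseteq> r"
        using vec.subspace_0[OF sx] vec.subspace_0[OF sp] by (force simp: r_def)+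
      moreover from calculation have "{(p', H) | p'. p' \<in> pg_points \<and> p' \<subseteq> r} \<in> flag_lines"
        using H unfolding flag_lines_def by (intro UnI1 CollectI exI[of _ r] exI[of _ H]) simp
      ultimately have "flag_collinear P (p, H)"
        using x p unfolding flag_collinear_def xH by (intro bexI) simp_all
      then show ?thesis ..
    qed (simp add: xH)
    then show ?thesis using True H by (intro L[of "(p, H)"]) simp_all
  next
    case False
    then have xA: "x \<subseteq> A" using alt by blast
    have "P = (x, A) \<or> flag_collinear P (x, A)"
    proof (cases "H = A")
      case ne: False
      define S where "S = A \<inter> H"
      have sS: "vec.subspace S" unfolding S_def using sA sH by (rule vec.subspace_inter)
      have "vec.dim S = CARD('n) - 2" using dim_hyperplane_Int A H ne by (auto simp: S_def)
      then have "S \<in> pg_colines" using sS by (simp add: pg_colines_def pg_subspaces_def)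
      moreover have "x \<subseteq> S" "S \<subseteq> A" "S \<subseteq> H" using xA sub by (auto simp: S_def)
      moreover from calculation have "{(x, H') | H'. H' \<in> pg_hyperplanes \<and> S \<subseteq> H'} \<in> flag_lines"
        using x unfolding flag_lines_def by (intro UnI2 CollectI exI[of _ x] exI[of _ S]) simp
      ultimately have "flag_collinear P (x, A)"
        using H A unfolding flag_collinear_def xH by (intro bexI) simp_all
      then show ?thesis ..
    qed (simp add: xH)
    then show ?thesis using xA x by (intro L[of "(x, A)"]) simp_all
  qed
qed

section \<open>Counting over finite fields\<close>

text \<open>Independence makes the coefficient map injective; the extensional function space leaves
  a single coefficient function for each vector of the span.\<close>

lemma card_span_independent:
  fixes B :: "('a::{field,finite}^'n) set"
  assumes "vec.independent B"
  shows "card (vec.span B) = CARD('a) ^ card B"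
proof -
  have fin: "finite B" by simp
  let ?c = "\<lambda>u. \<Sum>v\<in>B. u v *s v"
  have "inj_on ?c (B \<rightarrow>\<^sub>E UNIV)"
  proof (rule inj_onI)
    fix u w assume u: "u \<in> B \<rightarrow>\<^sub>E (UNIV :: 'a set)" and w: "w \<in> B \<rightarrow>\<^sub>E (UNIV :: 'a set)" and eq: "?c u = ?c w"
    then have "(\<Sum>v\<in>B. (u v - w v) *s v) = 0"
      using eq by (simp add: sum_subtractf vec.scale_left_diff_distrib)
    then have "u v - w v = 0" if "v \<in> B" for v
      using vec.independentD[OF assms fin subset_refl _ that, of "\<lambda>v. u v - w v"] by blast
    then have "u v = w v" if "v \<in> B" for v using that by fastforce
    then show "u = w" by (rule PiE_ext[OF u w])
  qed
  moreover have "?c ` (B \<rightarrow>\<^sub>E UNIV) = vec.span B"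
  proof -
    have "?c u \<in> ?c ` (B \<rightarrow>\<^sub>E UNIV)" for u
    proof (rule image_eqI[of _ _ "restrict u B"])
      show "?c u = ?c (restrict u B)" by (rule sum.cong) simp_all
    qed simp
    then have "range ?c \<subseteq> ?c ` (B \<rightarrow>\<^sub>E UNIV)" by (rule image_subsetI)
    then show ?thesis unfolding vec.span_finite[OF fin] by (rule subset_antisym[OF image_mono[OF subset_UNIV]])
  qed
  ultimately have "card (vec.span B) = card (B \<rightarrow>\<^sub>E (UNIV :: 'a set))"
    using card_image by fastforce
  also have "\<dots> = CARD('a) ^ card B" by (simp add: card_PiE)
  finally show ?thesis .
qed

lemma card_subspace:
  fixes W :: "('a::{field,finite}^'n) set"
  assumes "vec.subspace W"
  shows "card W = CARD('a) ^ vec.dim W"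
proof -
  obtain B where "vec.independent B" "vec.span B = W" "card B = vec.dim W"
    by (rule vec.basis_subspace_exists[OF assms])
  then show ?thesis using card_span_independent[of B] by simp
qed

text \<open>The expansion of \<open>(a - 1) * (b - 1)\<close>, rearranged so that linear arithmetic
  can use it despite natural subtraction.\<close>

lemma pred_mult_pred:
  fixes a b :: nat
  assumes "a \<ge> 1" "b \<ge> 1"
  shows "(a - 1) * (b - 1) + a + b = a * b + 1"
  using assms by (cases a; cases b) simp_all

lemma field_card_ge2: "CARD('a::{field,finite}) \<ge> 2"
proof -
  have "card {0, 1 :: 'a} \<le> CARD('a)" by (rule card_mono) auto
  then show ?thesis by simp
qed

lemma card_row_class:
  fixes x :: "'a::{field,finite}^'n"
  assumes "x \<noteq> 0"
  shows "card (row_class x) = CARD('a) ^ (CARD('n) - 1)"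
  using assms by (simp add: card_subspace subspace_row_class dim_row_class)

text \<open>The functionals killing \<open>x\<close> form a hyperplane. Those that kill
  \<open>y\<close> as well form a subspace of codimension two, since \<open>y\<close> is not a
  multiple of \<open>x\<close> and the two hyperplanes therefore differ.\<close>

lemma card_separating_functionals:
  fixes x y :: "'a::{field,finite}^'n"
  assumes x: "x \<noteq> 0" and y: "y \<notin> vec.span {x}"
  shows "card {\<xi>. dotp \<xi> x = 0 \<and> dotp \<xi> y \<noteq> 0} = CARD('a) ^ (CARD('n) - 1) - CARD('a) ^ (CARD('n) - 2)"
proof -
  have y0: "y \<noteq> 0" using y vec.span_zero by blast
  have "row_class x \<noteq> row_class y"
  proof
    assume "row_class x = row_class y"
    then obtain d where "y = d *s x" using row_class_eqD[OF x y0] by blast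
    then show False using y by (auto simp: vec.span_singleton)
  qed
  moreover have "row_class x \<in> pg_hyperplanes" "row_class y \<in> pg_hyperplanes"
    using x y0 by (auto simp: hyperplane_row_class)
  ultimately have "card (row_class x \<inter> row_class y) = CARD('a) ^ (CARD('n) - 2)"
    by (simp add: card_subspace subspace_row_class vec.subspace_inter dim_hyperplane_Int)
  moreover have "{\<xi>. dotp \<xi> x = 0 \<and> dotp \<xi> y \<noteq> 0} = row_class x - row_class x \<inter> row_class y"
    by (auto simp: in_row_class dotp_commute)
  ultimately show ?thesis using x by (simp add: card_Diff_subset card_row_class)
qed

lemma card_Collect_pairs: "card {(x :: 'a::finite, y :: 'b::finite). P x y} = (\<Sum>x\<in>UNIV. card {y. P x y})"
proof -
  have "{(x, y). P x y} = (SIGMA x:UNIV. {y. P x y})" by auto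
  then show ?thesis using card_SigmaI[of UNIV "\<lambda>x. {y. P x y}"] by simp
qed

lemma card_span_singleton:
  fixes u :: "'a::{field,finite}^'n"
  assumes "u \<noteq> 0"
  shows "card (vec.span {u}) = CARD('a)"
  using assms by (simp add: card_subspace)

section \<open>Field automorphisms and their fixed fields\<close>

definition fixed_field :: "('a \<Rightarrow> 'a) \<Rightarrow> 'a set" where
  "fixed_field \<sigma> = {a. \<sigma> a = a}"

locale field_automorphism =
  fixes \<sigma> :: "'a::field \<Rightarrow> 'a"
  assumes aut: "field_aut \<sigma>"
begin

lemma aut_add: "\<sigma> (a + b) = \<sigma> a + \<sigma> b" and aut_mult: "\<sigma> (a * b) = \<sigma> a * \<sigma> b" and aut_1: "\<sigma> 1 = 1"
  and aut_bij: "bij \<sigma>"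
  using aut by (auto simp: field_aut_def)

lemma aut_0: "\<sigma> 0 = 0" using aut_add[of 0 0] by (simp only: add_0_left add_cancel_right_right)

lemma aut_inj: "\<sigma> a = \<sigma> b \<longleftrightarrow> a = b" using aut_bij by (simp add: bij_is_inj inj_eq)

lemma aut_eq_0: "\<sigma> a = 0 \<longleftrightarrow> a = 0" using aut_inj[of a 0] by (simp add: aut_0)

lemma aut_diff: "\<sigma> (a - b) = \<sigma> a - \<sigma> b" using aut_add[of "a - b" b] by (simp add: algebra_simps)

lemma aut_divide: "\<sigma> (a / b) = \<sigma> a / \<sigma> b"
proof (cases "b = 0")
  case False
  then show ?thesis using aut_mult[of "a / b" b] by (simp add: aut_eq_0 field_simps)
qed (simp add: aut_0)

lemma aut_sum: "\<sigma> (\<Sum>x\<in>A. g x) = (\<Sum>x\<in>A. \<sigma> (g x))"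
  by (induction A rule: infinite_finite_induct) (simp_all add: aut_0 aut_add)

end

locale finite_field_automorphism = field_automorphism \<sigma> for \<sigma> :: "'a::{field,finite} \<Rightarrow> 'a"
begin

lemma fixed_field_ge2: "card (fixed_field \<sigma>) \<ge> 2"
proof -
  have "card {0, 1 :: 'a} \<le> card (fixed_field \<sigma>)"
    by (rule card_mono) (auto simp: fixed_field_def aut_0 aut_1)
  then show ?thesis by simp
qed

text \<open>An element \<open>a\<close> moved by \<open>\<sigma>\<close> is independent of 1 over
  the fixed field: subtracting a relation from its conjugate leaves only a multiple of
  \<open>\<sigma> a - a\<close>.\<close>

lemma card_fixed_field_square:
  assumes "\<sigma> \<noteq> id"
  shows "card (fixed_field \<sigma>) ^ 2 \<le> CARD('a)"
proof -
  obtain a where a: "\<sigma> a \<noteq> a" using assms by (auto simp: fun_eq_iff)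
  let ?h = "\<lambda>(u, v). u + v * a"
  have "inj_on ?h (fixed_field \<sigma> \<times> fixed_field \<sigma>)"
  proof (rule inj_onI, clarify)
    fix u v u' v'
    assume fx: "u \<in> fixed_field \<sigma>" "v \<in> fixed_field \<sigma>" "u' \<in> fixed_field \<sigma>" "v' \<in> fixed_field \<sigma>"
      and eq: "u + v * a = u' + v' * a"
    have "\<sigma> (u + v * a) = \<sigma> (u' + v' * a)" using eq by simp
    then have "u + v * \<sigma> a = u' + v' * \<sigma> a" using fx by (simp add: fixed_field_def aut_add aut_mult)
    with eq have "(v - v') * (\<sigma> a - a) = 0" by algebra
    then have "v = v'" using a by simp
    then show "u = u' \<and> v = v'" using eq by simp
  qed
  then have "card (fixed_field \<sigma> \<times> fixed_field \<sigma>) \<le> CARD('a)" by (rule card_inj_on_le) auto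
  then show ?thesis by (simp add: card_cartesian_product power2_eq_square)
qed

text \<open>An element moved by \<open>\<sigma>\<^sup>2\<close> has three distinct conjugates, hence satisfies no quadratic
  equation over the fixed field.\<close>

lemma card_fixed_field_cube:
  assumes "\<sigma> \<circ> \<sigma> \<noteq> id"
  shows "card (fixed_field \<sigma>) ^ 3 \<le> CARD('a)"
proof -
  obtain a where a: "\<sigma> (\<sigma> a) \<noteq> a" using assms by (auto simp: fun_eq_iff)
  then have a1: "\<sigma> a \<noteq> a" by auto
  let ?F = "fixed_field \<sigma>"
  let ?h = "\<lambda>(u, v, w). u + v * a + w * a^2"
  have "inj_on ?h (?F \<times> ?F \<times> ?F)"
  proof (rule inj_onI)
    fix s t assume st: "s \<in> ?F \<times> ?F \<times> ?F" "t \<in> ?F \<times> ?F \<times> ?F" "?h s = ?h t"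
    obtain u v w u' v' w' where uvw: "s = (u, v, w)" "t = (u', v', w')" by (cases s, cases t) blast
    have fx: "u \<in> ?F" "v \<in> ?F" "w \<in> ?F" "u' \<in> ?F" "v' \<in> ?F" "w' \<in> ?F"
      and eq: "u + v * a + w * a^2 = u' + v' * a + w' * a^2"
      using st by (simp_all add: uvw)
    have "\<sigma> (u + v * a + w * a^2) = \<sigma> (u' + v' * a + w' * a^2)" using eq by simp
    then have "u + v * \<sigma> a + w * (\<sigma> a)^2 = u' + v' * \<sigma> a + w' * (\<sigma> a)^2"
      using fx by (simp add: fixed_field_def aut_add aut_mult power2_eq_square)
    \<comment> \<open>First divided difference of the relation at the nodes \<open>a\<close> and
      \<open>\<sigma> a\<close>. Conjugating once more and subtracting gives the second one, in
      which only \<open>w - w'\<close> remains.\<close>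
    with eq have "((v - v') + (w - w') * (\<sigma> a + a)) * (\<sigma> a - a) = 0" by algebra
    then have 1: "(v - v') + (w - w') * (\<sigma> a + a) = 0" using a1 by simp
    have "\<sigma> ((v - v') + (w - w') * (\<sigma> a + a)) = 0" using 1 by (simp add: aut_0)
    then have "(v - v') + (w - w') * (\<sigma> (\<sigma> a) + \<sigma> a) = 0"
      using fx by (simp add: fixed_field_def aut_add aut_mult aut_diff)
    with 1 have "(w - w') * (\<sigma> (\<sigma> a) - a) = 0" by algebra
    then have "w = w'" using a by simp
    moreover from this have "v = v'" using 1 by simp
    ultimately show "s = t" using eq by (simp add: uvw)
  qed
  then have "card (?F \<times> ?F \<times> ?F) \<le> CARD('a)" by (rule card_inj_on_le) auto
  then show ?thesis by (simp add: card_cartesian_product power3_eq_cube mult.assoc)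
qed

text \<open>The quotient of a solution by a fixed nonzero solution \<open>c0\<close> is invariant
  under \<open>\<sigma>\<close>, so all solutions are multiples of \<open>c0\<close> by elements of
  the fixed field.\<close>

lemma card_twisted_eigenvalue_ratio:
  assumes "l \<noteq> 0" "m \<noteq> 0"
  shows "card {c. \<sigma> c * l = m * c} \<le> card (fixed_field \<sigma>)"
proof (cases "\<exists>c0. c0 \<noteq> 0 \<and> \<sigma> c0 * l = m * c0")
  case True
  then obtain c0 where c0: "c0 \<noteq> 0" "\<sigma> c0 * l = m * c0" by blast
  have "c \<in> (\<lambda>a. a * c0) ` fixed_field \<sigma>" if c: "\<sigma> c * l = m * c" for c
  proof
    show "c = c / c0 * c0" using c0 by simp
    have "\<sigma> c = m * c / l" "\<sigma> c0 = m * c0 / l" using c c0 assms by (simp_all add: field_simps)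
    then show "c / c0 \<in> fixed_field \<sigma>" using assms c0 by (simp add: fixed_field_def aut_divide)
  qed
  then have "{c. \<sigma> c * l = m * c} \<subseteq> (\<lambda>a. a * c0) ` fixed_field \<sigma>" by blast
  then have "card {c. \<sigma> c * l = m * c} \<le> card ((\<lambda>a. a * c0) ` fixed_field \<sigma>)" by (intro card_mono) auto
  also have "\<dots> \<le> card (fixed_field \<sigma>)" by (rule card_image_le) simp
  finally show ?thesis .
next
  case False
  then have "{c. \<sigma> c * l = m * c} \<subseteq> {0}" by blast
  then have "card {c. \<sigma> c * l = m * c} \<le> card {0 :: 'a}" by (rule card_mono[rotated]) simp
  then show ?thesis using fixed_field_ge2 by simp
qed

end

section \<open>Eigenvectors of semilinear maps\<close>

locale semilinear_map = finite_field_automorphism \<sigma> for \<sigma> :: "'a::{field,finite} \<Rightarrow> 'a" +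
  fixes f :: "'a^'n \<Rightarrow> 'a^'n"
  assumes f_add: "f (x + y) = f x + f y" and f_scale: "f (c *s x) = \<sigma> c *s f x"
begin

lemma f_0: "f 0 = 0" using f_add[of 0 0] by simp

lemma f_sum: "f (\<Sum>v\<in>B. u v *s v) = (\<Sum>v\<in>B. \<sigma> (u v) *s f v)"
  by (induction B rule: infinite_finite_induct) (simp_all add: f_0 f_add f_scale)

definition kernel where "kernel = {x. f x = 0}"

text \<open>The zero vector and the whole kernel are included: these are the \<open>x\<close> for
  which every functional killing \<open>x\<close> also kills \<open>f x\<close>.\<close>

definition eigenvectors where "eigenvectors = {x. \<exists>l. f x = l *s x}"

lemma subspace_kernel: "vec.subspace kernel"
  by (auto simp: kernel_def vec.subspace_def f_0 f_add f_scale)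

text \<open>In the coordinates of a basis of eigenvectors, each coordinate of an eigenvector with
  eigenvalue \<open>m\<close> ranges over an at most one-dimensional space over the fixed field.\<close>

lemma card_eigenspace:
  assumes B: "vec.independent B" and l: "\<And>v. v \<in> B \<Longrightarrow> l v \<noteq> 0 \<and> f v = l v *s v" and m: "m \<noteq> 0"
  shows "card {x \<in> vec.span B. f x = m *s x} \<le> card (fixed_field \<sigma>) ^ card B"
proof -
  have fin: "finite B" by simp
  let ?c = "\<lambda>u. \<Sum>v\<in>B. u v *s v"
  let ?C = "\<lambda>v. {c. \<sigma> c * l v = m * c}"
  have "{x \<in> vec.span B. f x = m *s x} \<subseteq> ?c ` (Pi\<^sub>E B ?C)"
  proof clarify
    fix x assume "x \<in> vec.span B" and fx: "f x = m *s x"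
    then obtain u where x: "x = ?c u" unfolding vec.span_finite[OF fin] by blast
    have "(\<Sum>v\<in>B. (\<sigma> (u v) * l v - m * u v) *s v) = 0"
      using fx l unfolding x f_sum by (simp add: vec.scale_sum_right sum_subtractf vec.scale_left_diff_distrib)
    then have "\<sigma> (u v) * l v - m * u v = 0" if "v \<in> B" for v
      using vec.independentD[OF B fin subset_refl _ that, of "\<lambda>v. \<sigma> (u v) * l v - m * u v"] by blast
    then have "restrict u B \<in> Pi\<^sub>E B ?C" by auto
    moreover have "x = ?c (restrict u B)" unfolding x by (rule sum.cong) simp_all
    ultimately show "x \<in> ?c ` (Pi\<^sub>E B ?C)" by blast
  qed
  then have "card {x \<in> vec.span B. f x = m *s x} \<le> card (?c ` (Pi\<^sub>E B ?C))"
    by (intro card_mono) auto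
  also have "\<dots> \<le> card (Pi\<^sub>E B ?C)" by (rule card_image_le) (simp add: finite_PiE)
  also have "\<dots> = (\<Prod>v\<in>B. card (?C v))" by (simp add: card_PiE)
  also have "\<dots> \<le> (\<Prod>v\<in>B. card (fixed_field \<sigma>))"
    using l m by (intro prod_mono) (simp add: card_twisted_eigenvalue_ratio)
  finally show ?thesis by simp
qed

text \<open>Here \<open>m\<close> is the size of a maximal independent set \<open>B\<close> of
  eigenvectors with nonzero eigenvalues. Its span meets the kernel trivially, whence the bound on
  \<open>m\<close>. By maximality the span contains all such eigenvectors, and each of the
  \<open>CARD('a) - 1\<close> nonzero eigenvalues contributes at most the size of its eigenspace
  without 0.\<close>

lemma card_eigenvectors_le:
  obtains m where "m + vec.dim kernel \<le> CARD('n)"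
    "card eigenvectors \<le> CARD('a) ^ vec.dim kernel + (CARD('a) - 1) * (card (fixed_field \<sigma>) ^ m - 1)"
proof -
  define E where "E = {x. x \<noteq> 0 \<and> (\<exists>l. l \<noteq> 0 \<and> f x = l *s x)}"
  obtain B where B: "B \<subseteq> E" "vec.independent B" "E \<subseteq> vec.span B"
    by (rule vec.maximal_independent_subset)
  have fin: "finite B" by simp
  have "\<forall>v\<in>B. \<exists>l. l \<noteq> 0 \<and> f v = l *s v" using B(1) by (auto simp: E_def)
  then obtain l where l: "\<And>v. v \<in> B \<Longrightarrow> l v \<noteq> 0 \<and> f v = l v *s v" by metis
  \<comment> \<open>On the span of \<open>B\<close>, \<open>f\<close> only twists the coordinates
    and scales them by the nonzero \<open>l v\<close>, so it kills nothing but 0.\<close>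
  have "vec.span B \<inter> kernel \<subseteq> {0}"
  proof clarify
    fix x assume "x \<in> vec.span B" and fx: "x \<in> kernel"
    then obtain u where x: "x = (\<Sum>v\<in>B. u v *s v)" unfolding vec.span_finite[OF fin] by blast
    have "(\<Sum>v\<in>B. (\<sigma> (u v) * l v) *s v) = 0"
      using fx l unfolding x kernel_def by (simp add: f_sum)
    then have "\<sigma> (u v) * l v = 0" if "v \<in> B" for v
      using vec.independentD[OF B(2) fin subset_refl _ that, of "\<lambda>v. \<sigma> (u v) * l v"] by blast
    then have "u v = 0" if "v \<in> B" for v using l that aut_eq_0 by fastforce
    then show "x = 0" unfolding x by simp
  qed
  then have "vec.dim (vec.span B \<inter> kernel) = 0" by (simp only: vec.dim_eq_0)
  then have "vec.dim {a + b | a b. a \<in> vec.span B \<and> b \<in> kernel} = card B + vec.dim kernel"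
    using vec.dim_sums_Int[OF vec.subspace_span[of B] subspace_kernel]
      vec.dim_span_eq_card_independent[OF B(2)] by linarith
  moreover have "vec.dim {a + b | a b. a \<in> vec.span B \<and> b \<in> kernel} \<le> CARD('n)"
    by (rule vec_dim_le_card)
  ultimately have dims: "card B + vec.dim kernel \<le> CARD('n)" by linarith
  define q0 where "q0 = card (fixed_field \<sigma>)"
  \<comment> \<open>The zero vector lies in every eigenspace and is already counted in the kernel,
    so it is removed here.\<close>
  let ?V = "\<lambda>m. {x \<in> vec.span B. f x = m *s x} - {0}"
  have V: "card (?V m) \<le> q0 ^ card B - 1" if "m \<in> UNIV - {0}" for m
  proof -
    have "card {x \<in> vec.span B. f x = m *s x} \<le> q0 ^ card B"
      using card_eigenspace[OF B(2) l] that by (simp add: q0_def)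
    moreover have "0 \<in> {x \<in> vec.span B. f x = m *s x}" by (simp add: f_0 vec.span_zero)
    ultimately show ?thesis by (simp add: card_Diff_singleton)
  qed
  have "E \<subseteq> (\<Union>m\<in>UNIV - {0}. ?V m)" using B(3) by (auto simp: E_def)
  then have "card E \<le> card (\<Union>m\<in>UNIV - {0}. ?V m)" by (intro card_mono) auto
  also have "\<dots> \<le> (\<Sum>m\<in>UNIV - {0}. card (?V m))" by (rule card_UN_le) simp
  also have "\<dots> \<le> (\<Sum>m\<in>UNIV - {0 :: 'a}. q0 ^ card B - 1)" using V by (rule sum_mono)
  also have "\<dots> = (CARD('a) - 1) * (q0 ^ card B - 1)" by (simp add: card_Diff_singleton)
  finally have E: "card E \<le> (CARD('a) - 1) * (q0 ^ card B - 1)" .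
  have "eigenvectors \<subseteq> kernel \<union> E"
    by (auto simp: eigenvectors_def kernel_def E_def f_0 vec.scale_eq_0_iff)
  then have "card eigenvectors \<le> card (kernel \<union> E)" by (intro card_mono) auto
  also have "\<dots> \<le> card kernel + card E" by (rule card_Un_le)
  finally show ?thesis
    using that[OF dims] E by (simp add: card_subspace subspace_kernel q0_def)
qed

text \<open>The preceding bound is compared with \<open>q ^ n\<close>. For a nontrivial kernel it
  suffices that \<open>q0 ^ m \<le> q ^ (r - 1)\<close>, where \<open>r\<close> is the codimension
  of the kernel. For a trivial kernel the exponent \<open>r - 1 = n\<close> is too large and
  \<open>n - 1\<close> is required.\<close>

lemma card_eigenvectors_less:
  assumes "CARD('n) \<ge> 3" "\<sigma> \<noteq> id" "CARD('n) > 3 \<or> \<sigma> \<circ> \<sigma> \<noteq> id"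
    and k: "vec.dim kernel + 2 \<le> CARD('n)"
  shows "card eigenvectors < CARD('a) ^ (CARD('n) - 1)"
proof -
  define n where "n = CARD('n) - 1"
  have n: "CARD('n) = n + 1" "n \<ge> 2" using assms(1) by (simp_all add: n_def)
  define q where "q = CARD('a)"
  define q0 where "q0 = card (fixed_field \<sigma>)"
  define k where "k = vec.dim kernel"
  have q: "q \<ge> 2" "q0 \<ge> 2" by (simp_all add: q_def q0_def field_card_ge2 fixed_field_ge2)
  have sq: "q0 ^ 2 \<le> q" unfolding q_def q0_def by (rule card_fixed_field_square[OF assms(2)])
  obtain m where m: "m + k \<le> n + 1" and le: "card eigenvectors \<le> q ^ k + (q - 1) * (q0 ^ m - 1)"
    using card_eigenvectors_le n unfolding q_def q0_def k_def by metis
  have kn: "k + 2 \<le> n + 1" using k n by (simp add: k_def)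
  define r where "r = n + 1 - k"
  have r: "r + k = n + 1" "r \<ge> 2" "m \<le> r" using kn m by (auto simp: r_def)
  have "q0 ^ m \<le> q0 ^ r" using r q by (intro power_increasing) auto
  also have bound: "q0 ^ r \<le> q ^ (if k = 0 then n - 1 else r - 1)"
  \<comment> \<open>From \<open>q0 ^ 2 \<le> q\<close> the bound follows whenever \<open>r\<close>
    is at most twice the exponent. For \<open>k = 0\<close> this reads
    \<open>n + 1 \<le> 2 * (n - 1)\<close> and fails exactly for \<open>n = 2\<close>, where the
    cubic bound on the fixed field takes over.\<close>
  proof (cases "k = 0 \<and> n = 2")
    case True
    then have "\<sigma> \<circ> \<sigma> \<noteq> id" using assms(3) n by simp
    then have "q0 ^ 3 \<le> q" unfolding q_def q0_def by (rule card_fixed_field_cube)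
    then show ?thesis using True r by simp
  next
    case False
    let ?e = "if k = 0 then n - 1 else r - 1"
    have "r \<le> 2 * ?e" using r n False by auto
    then have "q0 ^ r \<le> q0 ^ (2 * ?e)" using q by (intro power_increasing) auto
    also have "\<dots> = (q0 ^ 2) ^ ?e" by (simp add: power_mult)
    also have "\<dots> \<le> q ^ ?e" using sq by (rule power_mono) simp
    finally show ?thesis .
  qed
  finally have b: "q0 ^ m \<le> q ^ (if k = 0 then n - 1 else r - 1)" .
  have le': "card eigenvectors \<le> q ^ k + (q - 1) * (q ^ (if k = 0 then n - 1 else r - 1) - 1)"
    using le b by (meson add_left_mono diff_le_mono le_trans mult_le_mono2)
  have "card eigenvectors < q ^ n"
  proof (cases "k = 0")
    case True
    have "q ^ (n - 1) \<ge> 2"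
      using self_le_power[of q "n - 1"] q n by simp
    \<comment> \<open>With \<open>b = q ^ (n - 1)\<close> the left side is
      \<open>q * b + 2 - q - b\<close>, and both \<open>q\<close> and \<open>b\<close> are at least
      2.\<close>
    then have "1 + (q - 1) * (q ^ (n - 1) - 1) < q * q ^ (n - 1)"
      using pred_mult_pred[of q "q ^ (n - 1)"] q by linarith
    then show ?thesis using le' True n by (cases n) simp_all
  next
    case False
    define a where "a = q ^ (r - 1)"
    have a: "a \<ge> 2" unfolding a_def using self_le_power[of q "r - 1"] q r by simp
    have qk: "q ^ k \<ge> q" using self_le_power[of q k] q False by simp
    \<comment> \<open>Since \<open>k \<ge> 1\<close>, the factor \<open>q - 1\<close> may be
      enlarged to \<open>q ^ k\<close>; the summand \<open>q ^ k\<close> then completes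
      \<open>q ^ k * (a - 1)\<close> to \<open>q ^ k * a = q ^ n\<close>.\<close>
    have "(q - 1) * (a - 1) < q * (a - 1)" using q a by simp
    also have "\<dots> \<le> q ^ k * (a - 1)" using qk by (rule mult_le_mono1)
    also have "\<dots> = q ^ k * a - q ^ k" by (simp add: diff_mult_distrib2)
    finally have "q ^ k + (q - 1) * (a - 1) < q ^ k * a" by linarith
    also have "q ^ k * a = q ^ (k + (r - 1))" by (simp only: a_def power_add)
    also have "k + (r - 1) = n" using r by linarith
    finally show ?thesis using le' False by (simp add: a_def)
  qed
  then show ?thesis using n by (simp add: q_def)
qed

end

section \<open>Semilinear maps of rank one and the count of moved pairs\<close>

context semilinear_map
begin

lemma eq_0_if_dim_kernel_full: "vec.dim kernel = CARD('n) \<Longrightarrow> f x = 0"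
proof -
  assume "vec.dim kernel = CARD('n)"
  then have "kernel = UNIV"
    using vec.subspace_dim_equal[OF subspace_kernel vec.subspace_UNIV subset_UNIV]
    by (simp only: vec_dim_card order_refl)
  then show ?thesis by (auto simp: kernel_def)
qed

text \<open>The kernel is a hyperplane \<open>row_class \<beta>\<close>. Subtracting
  \<open>dotp \<beta> x *s x0\<close>, where \<open>dotp \<beta> x0 = 1\<close>, moves
  \<open>x\<close> into it, so \<open>f\<close> is determined by \<open>u = f x0\<close>.\<close>

lemma rank_one_decomposition:
  assumes "vec.dim kernel = CARD('n) - 1"
  obtains u \<beta> where "u \<noteq> 0" "\<beta> \<noteq> 0" "\<And>x. f x = \<sigma> (dotp \<beta> x) *s u"
proof -
  have "kernel \<in> pg_hyperplanes"
    using assms subspace_kernel by (simp add: pg_hyperplanes_def pg_subspaces_def)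
  then obtain \<beta> where b: "\<beta> \<noteq> 0" "kernel = row_class \<beta>" unfolding hyperplane_row_class by blast
  obtain x0 where x0: "dotp \<beta> x0 = 1" using dotp_separates b(1) by blast
  have ker: "f x = 0 \<longleftrightarrow> dotp \<beta> x = 0" for x
    using b(2) in_row_class[of x \<beta>] by (auto simp: kernel_def)
  have "f x0 \<noteq> 0" using x0 ker by simp
  moreover have "f x = \<sigma> (dotp \<beta> x) *s f x0" for x
  proof -
    have "f (x - dotp \<beta> x *s x0) = 0" unfolding ker using x0 by simp
    moreover have "f x = f (x - dotp \<beta> x *s x0) + f (dotp \<beta> x *s x0)"
      by (simp flip: f_add)
    ultimately show ?thesis by (simp add: f_scale)
  qed
  ultimately show ?thesis using that b(1) by blast
qed

text \<open>Outside the kernel \<open>f x\<close> is a nonzero multiple of \<open>u\<close>, so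
  \<open>x\<close> can be an eigenvector only if it is itself a multiple of
  \<open>u\<close>.\<close>

lemma eigenvectors_rank_one:
  assumes u: "u \<noteq> 0" and f: "\<And>x. f x = \<sigma> (dotp \<beta> x) *s u"
  shows "eigenvectors = row_class \<beta> \<union> vec.span {u}"
proof (intro equalityI subsetI)
  fix x assume "x \<in> eigenvectors"
  then obtain l where l: "\<sigma> (dotp \<beta> x) *s u = l *s x" by (auto simp: eigenvectors_def f)
  show "x \<in> row_class \<beta> \<union> vec.span {u}"
  proof (cases "dotp \<beta> x = 0")
    case False
    then have nz: "\<sigma> (dotp \<beta> x) *s u \<noteq> 0" using u by (simp add: aut_eq_0)
    then have l0: "l \<noteq> 0" using l by auto
    have "(1 / l) *s (\<sigma> (dotp \<beta> x) *s u) = x" unfolding l using l0 by simp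
    then have "x = (\<sigma> (dotp \<beta> x) / l) *s u" by simp
    then show ?thesis unfolding vec.span_singleton by blast
  qed (simp add: in_row_class)
next
  fix x assume "x \<in> row_class \<beta> \<union> vec.span {u}"
  then consider "dotp \<beta> x = 0" | c where "x = c *s u" "dotp \<beta> x \<noteq> 0"
    unfolding vec.span_singleton in_row_class[symmetric] by blast
  then show "x \<in> eigenvectors"
  proof cases
    case 1
    then have "f x = 0 *s x" by (simp add: f aut_0)
    then show ?thesis unfolding eigenvectors_def by blast
  next
    case 2
    then have "c \<noteq> 0" by auto
    with 2 have "f x = (\<sigma> (dotp \<beta> x) / c) *s x" by (simp add: f)
    then show ?thesis unfolding eigenvectors_def by blast
  qed
qed

text \<open>The line of \<open>u\<close> either lies in the hyperplane and adds nothing, or meets it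
  only in 0 and adds its nonzero vectors. The two counts tell singular from non-singular
  quasi-singular hyperplanes.\<close>

lemma card_eigenvectors_rank_one:
  assumes u: "u \<noteq> 0" and b: "\<beta> \<noteq> 0" and f: "\<And>x. f x = \<sigma> (dotp \<beta> x) *s u"
  shows "card eigenvectors =
    (if dotp \<beta> u = 0 then CARD('a) ^ (CARD('n) - 1) else CARD('a) ^ (CARD('n) - 1) + (CARD('a) - 1))"
proof (cases "dotp \<beta> u = 0")
  case True
  then have "vec.span {u} \<subseteq> row_class \<beta>" by (auto simp: vec.span_singleton in_row_class)
  then show ?thesis using True b by (simp add: eigenvectors_rank_one[OF u f] Un_absorb2 card_row_class)
next
  case False
  then have "row_class \<beta> \<inter> vec.span {u} = {0}" by (auto simp: vec.span_singleton in_row_class)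
  then have "card (row_class \<beta>) + card (vec.span {u}) = card eigenvectors + card {0 :: 'a^'n}"
    using card_Un_Int[of "row_class \<beta>" "vec.span {u}"] by (simp add: eigenvectors_rank_one[OF u f])
  then show ?thesis
    using False field_card_ge2[where 'a = 'a] by (simp add: card_row_class[OF b] card_span_singleton[OF u])
qed

text \<open>The kernel of a nonzero map has codimension one or at least two. Three cases arise once
  \<open>card_eigenvectors_rank_one\<close> splits the second alternative.\<close>

lemma card_eigenvectors_trichotomy:
  assumes "CARD('n) \<ge> 3" "\<sigma> \<noteq> id" "CARD('n) > 3 \<or> \<sigma> \<circ> \<sigma> \<noteq> id" and "f x \<noteq> 0"
  shows "card eigenvectors < CARD('a) ^ (CARD('n) - 1) \<or>
    (\<exists>u \<beta>. u \<noteq> 0 \<and> \<beta> \<noteq> 0 \<and> (\<forall>x. f x = \<sigma> (dotp \<beta> x) *s u))"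
proof -
  have "vec.dim kernel \<noteq> CARD('n)" using eq_0_if_dim_kernel_full assms(4) by blast
  then consider "vec.dim kernel + 2 \<le> CARD('n)" | "vec.dim kernel = CARD('n) - 1"
    using vec_dim_le_card[of kernel] by linarith
  then show ?thesis
  proof cases
    case 1
    then show ?thesis using card_eigenvectors_less assms(1-3) by blast
  next
    case 2
    then obtain u \<beta> where "u \<noteq> 0" "\<beta> \<noteq> 0" "\<And>x. f x = \<sigma> (dotp \<beta> x) *s u"
      using rank_one_decomposition by blast
    then show ?thesis by blast
  qed
qed

text \<open>Coordinate pairs of the flags where the codeword entry is nonzero, all scalings
  included; the inequality already forces both vectors to be nonzero.\<close>

definition moved_pairs where
  "moved_pairs = {(x, \<xi>). dotp \<xi> x = 0 \<and> dotp \<xi> (f x) \<noteq> 0}"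

text \<open>Summation over \<open>x\<close>: an eigenvector contributes nothing, and any other
  vector contributes the constant of \<open>card_separating_functionals\<close>.\<close>

lemma card_moved_pairs:
  "card moved_pairs =
    (CARD('a) ^ (CARD('n) - 1) - CARD('a) ^ (CARD('n) - 2)) * (CARD('a) ^ CARD('n) - card eigenvectors)"
  (is "_ = ?D * _")
proof -
  have "card {\<xi>. dotp \<xi> x = 0 \<and> dotp \<xi> (f x) \<noteq> 0} = (if x \<in> eigenvectors then 0 else ?D)" for x
  proof (cases "x \<in> eigenvectors")
    case True
    then obtain l where "f x = l *s x" by (auto simp: eigenvectors_def)
    then have "{\<xi>. dotp \<xi> x = 0 \<and> dotp \<xi> (f x) \<noteq> 0} = {}" by auto
    then show ?thesis using True by (simp only: card.empty if_True)
  next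
    case False
    have "x \<noteq> 0"
    proof
      assume "x = 0"
      then have "f x = 0 *s x" by (simp add: f_0)
      then show False using False unfolding eigenvectors_def by blast
    qed
    moreover have "f x \<notin> vec.span {x}"
      using False unfolding eigenvectors_def vec.span_singleton by blast
    ultimately show ?thesis using False card_separating_functionals by simp
  qed
  then have "card moved_pairs = (\<Sum>x\<in>UNIV. if x \<in> eigenvectors then 0 else ?D)"
    unfolding moved_pairs_def card_Collect_pairs by (intro sum.cong refl)
  also have "\<dots> = ?D * card (- eigenvectors)" by (simp add: sum.If_cases)
  finally show ?thesis by (simp add: Compl_eq_Diff_UNIV card_Diff_subset)
qed

end

section \<open>Twisted matrices and the code\<close>

definition twisted_map :: "('a::field \<Rightarrow> 'a) \<Rightarrow> 'a^'n^'n \<Rightarrow> 'a^'n \<Rightarrow> 'a^'n" where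
  "twisted_map \<sigma> M x = M *v vec_twist \<sigma> x"

lemma twisted_map_nth: "twisted_map \<sigma> M x $ i = (\<Sum>j\<in>UNIV. M $ i $ j * \<sigma> (x $ j))"
  by (simp add: twisted_map_def vec_twist_def matrix_vector_mult_def)

lemma semilinear_twisted_map:
  fixes \<sigma> :: "'a::{field,finite} \<Rightarrow> 'a"
  assumes "field_aut \<sigma>"
  shows "semilinear_map \<sigma> (twisted_map \<sigma> M)"
proof -
  interpret finite_field_automorphism \<sigma> using assms by unfold_locales
  show ?thesis
    by unfold_locales
      (simp_all add: vec_eq_iff twisted_map_nth aut_add aut_mult algebra_simps sum.distrib sum_distrib_left)
qed

text \<open>Cyclicity of the trace in coordinates; it turns codeword entries into values of
  functionals on a semilinear map.\<close>

lemma trace_twisted_mat: "trace (twisted_mat \<sigma> x \<xi> ** M) = dotp \<xi> (twisted_map \<sigma> M x)"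
proof -
  have "trace (twisted_mat \<sigma> x \<xi> ** M) = (\<Sum>i\<in>UNIV. \<Sum>k\<in>UNIV. \<sigma> (x $ i) * \<xi> $ k * M $ k $ i)"
    by (simp add: trace_def matrix_matrix_mult_def twisted_mat_nth)
  also have "\<dots> = (\<Sum>k\<in>UNIV. \<Sum>i\<in>UNIV. \<sigma> (x $ i) * \<xi> $ k * M $ k $ i)" by (rule sum.swap)
  also have "\<dots> = dotp \<xi> (twisted_map \<sigma> M x)"
    by (simp add: dotp_def twisted_map_nth sum_distrib_left mult_ac)
  finally show ?thesis .
qed

text \<open>Unit vectors are unchanged by the twist, so their images are the columns of
  \<open>M\<close>.\<close>

lemma twisted_map_eq_0:
  assumes "field_aut \<sigma>" "\<And>x. twisted_map \<sigma> M x = 0"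
  shows "M = 0"
proof -
  interpret field_automorphism \<sigma> using assms(1) by unfold_locales
  have "M $ i $ j = twisted_map \<sigma> M (axis j 1) $ i" for i j
    by (simp add: twisted_map_nth axis_def aut_0 aut_1 if_distrib[of \<sigma>] if_distrib[where f = "(*) _"] cong: if_cong)
  then show ?thesis using assms(2) by (simp add: vec_eq_iff)
qed

text \<open>The entries of \<open>\<beta>\<close> are twisted so that the product with the twisted
  \<open>x\<close> becomes \<open>\<sigma>\<close> of the pairing of \<open>\<beta>\<close> and
  \<open>x\<close>.\<close>

definition rank_one_mat :: "('a::field \<Rightarrow> 'a) \<Rightarrow> 'a^'n \<Rightarrow> 'a^'n \<Rightarrow> 'a^'n^'n" where
  "rank_one_mat \<sigma> u \<beta> = (\<chi> i j. u $ i * \<sigma> (\<beta> $ j))"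

lemma twisted_map_rank_one:
  assumes "field_aut \<sigma>"
  shows "twisted_map \<sigma> (rank_one_mat \<sigma> u \<beta>) x = \<sigma> (dotp \<beta> x) *s u"
proof -
  interpret field_automorphism \<sigma> using assms by unfold_locales
  show ?thesis
    by (simp add: vec_eq_iff twisted_map_nth rank_one_mat_def dotp_def aut_sum aut_mult
        sum_distrib_left sum_distrib_right mult_ac)
qed

lemma mat_class_eqD:
  assumes "mat_class X = mat_class Y"
  obtains c where "X = map_matrix ((*) c) Y"
proof -
  have "map_matrix ((*) 1) X = X" by (simp add: vec_eq_iff map_matrix_def)
  then have "X \<in> mat_class X" unfolding mat_class_def mem_Collect_eq by metis
  then have "X \<in> mat_class Y" using assms by simp
  then show ?thesis using that by (auto simp: mat_class_def)
qed

lemma trace_scale: "trace (map_matrix ((*) c) X ** M) = c * trace (X ** M)"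
  by (simp add: trace_def matrix_matrix_mult_def map_matrix_def sum_distrib_left mult.assoc)

lemma trace_eq_0_mat_class:
  assumes "mat_class X = mat_class Y"
  shows "trace (X ** M) = 0 \<longleftrightarrow> trace (Y ** M) = 0"
proof -
  obtain c where "X = map_matrix ((*) c) Y" using mat_class_eqD[OF assms] .
  moreover obtain d where "Y = map_matrix ((*) d) X" using mat_class_eqD[OF assms[symmetric]] .
  ultimately show ?thesis by (metis trace_scale mult_zero_right)
qed

lemma twisted_mat_neq_0:
  assumes "field_aut \<sigma>" "x \<noteq> 0" "\<xi> \<noteq> 0"
  shows "twisted_mat \<sigma> x \<xi> \<noteq> 0"
proof -
  interpret field_automorphism \<sigma> using assms(1) by unfold_locales
  obtain i j where "x $ i \<noteq> 0" "\<xi> $ j \<noteq> 0" using assms(2,3) by (auto simp: vec_eq_iff)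
  then have "twisted_mat \<sigma> x \<xi> $ i $ j \<noteq> 0" by (simp add: twisted_mat_nth aut_eq_0)
  then show ?thesis by (metis zero_index)
qed

lemma mat_class_in_pg_mat_perp:
  assumes "X \<noteq> 0"
  shows "mat_class X \<in> pg_mat (mat_perp M) \<longleftrightarrow> trace (X ** M) = 0"
  using assms trace_eq_0_mat_class unfolding pg_mat_def mat_perp_def by blast

lemma twisted_preimage_perp:
  assumes aut: "field_aut \<sigma>" and flag: "x \<noteq> 0" "\<xi> \<noteq> 0" "dotp \<xi> x = 0"
  shows "(col_class x, row_class \<xi>) \<in> twisted_preimage \<sigma> (pg_mat (mat_perp M)) \<longleftrightarrow>
    dotp \<xi> (twisted_map \<sigma> M x) = 0"
proof -
  have "(col_class x, row_class \<xi>) \<in> flag_points" using flag by (auto simp: flag_points_eq)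
  then show ?thesis
    using flag aut by (simp add: twisted_preimage_def twisted_embedding_class mat_class_in_pg_mat_perp
        twisted_mat_neq_0 trace_twisted_mat)
qed

text \<open>On a flag with coordinates \<open>x\<close> and \<open>\<xi>\<close> the form is the
  product of \<open>\<sigma> (dotp \<beta> x)\<close> and \<open>dotp \<xi> u\<close>. Its two
  factors vanish exactly under the two alternatives of \<open>qs_hyperplane_eq\<close>.\<close>

lemma twisted_preimage_rank_one:
  fixes M :: "'a::{field,finite}^'n^'n"
  assumes aut: "field_aut \<sigma>" and nz: "u \<noteq> 0" "\<beta> \<noteq> 0"
    and M: "\<And>x. twisted_map \<sigma> M x = \<sigma> (dotp \<beta> x) *s u"
  shows "twisted_preimage \<sigma> (pg_mat (mat_perp M)) = qs_hyperplane (col_class u) (row_class \<beta>)"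
proof -
  interpret field_automorphism \<sigma> using aut by unfold_locales
  have pA: "col_class u \<in> pg_points" "row_class \<beta> \<in> pg_hyperplanes"
    using nz by (auto simp: points_col_class hyperplane_row_class)
  have "P \<in> twisted_preimage \<sigma> (pg_mat (mat_perp M)) \<longleftrightarrow> P \<in> qs_hyperplane (col_class u) (row_class \<beta>)"
    if P': "P \<in> flag_points" for P
  proof -
    obtain x \<xi> where P: "P = (col_class x, row_class \<xi>)" and x: "x \<noteq> 0" "\<xi> \<noteq> 0" "dotp \<xi> x = 0"
      using P' unfolding flag_points_eq by blast
    then show ?thesis
      using P' unfolding P twisted_preimage_perp[OF aut x] qs_hyperplane_eq[OF pA]
      by (auto simp: M aut_eq_0 col_subset_row)
  qed
  moreover have "twisted_preimage \<sigma> (pg_mat (mat_perp M)) \<subseteq> flag_points" by (auto simp: twisted_preimage_def)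
  moreover have "qs_hyperplane (col_class u) (row_class \<beta>) \<subseteq> flag_points" by (auto simp: qs_hyperplane_def)
  ultimately show ?thesis by blast
qed

lemma twisted_mat_class_eqD:
  assumes aut: "field_aut \<sigma>" and y: "y \<noteq> 0" "\<eta> \<noteq> 0"
    and eq: "mat_class (twisted_mat \<sigma> y \<eta>) = mat_class (twisted_mat \<sigma> x \<xi>)"
  obtains a b where "a \<noteq> 0" "b \<noteq> 0" "y = a *s x" "\<eta> = b *s \<xi>"
proof -
  interpret field_automorphism \<sigma> using aut by unfold_locales
  obtain c where "twisted_mat \<sigma> y \<eta> = map_matrix ((*) c) (twisted_mat \<sigma> x \<xi>)"
    using mat_class_eqD[OF eq] .
  then have "twisted_mat \<sigma> y \<eta> $ i $ j = map_matrix ((*) c) (twisted_mat \<sigma> x \<xi>) $ i $ j" for i j by simp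
  then have c: "\<sigma> (y $ i) * \<eta> $ j = c * (\<sigma> (x $ i) * \<xi> $ j)" for i j
    by (simp add: twisted_mat_nth map_matrix_def)
  obtain i j where ij: "y $ i \<noteq> 0" "\<eta> $ j \<noteq> 0" using y by (auto simp: vec_eq_iff)
  \<comment> \<open>Fixing column \<open>j\<close> compares \<open>y\<close> with \<open>x\<close>;
    surjectivity of \<open>\<sigma>\<close> writes the factor as \<open>\<sigma> a\<close>. Fixing
    row \<open>i\<close> below compares \<open>\<eta>\<close> with \<open>\<xi>\<close>.\<close>
  obtain a where a: "\<sigma> a = c * \<xi> $ j / \<eta> $ j" using aut_bij by (metis bij_pointE)
  have "\<sigma> (y $ k) = \<sigma> (a * x $ k)" for k
    using c[of k j] ij by (simp add: aut_mult a field_simps)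
  then have ya: "y = a *s x" by (simp add: vec_eq_iff aut_inj)
  define b where "b = c * \<sigma> (x $ i) / \<sigma> (y $ i)"
  have "\<eta> $ k = b * \<xi> $ k" for k
    using c[of i k] ij by (simp add: b_def aut_eq_0 field_simps)
  then have eb: "\<eta> = b *s \<xi>" by (simp add: vec_eq_iff)
  have "a \<noteq> 0" using y(1) ya by auto
  moreover have "b \<noteq> 0" using y(2) eb by auto
  ultimately show ?thesis using that ya eb by blast
qed

text \<open>Homogeneous coordinates are unique up to two independent nonzero scalars, one for each
  vector.\<close>

lemma card_twisted_mat_fibre:
  fixes x :: "'a::{field,finite}^'n"
  assumes aut: "field_aut \<sigma>" and nz: "x \<noteq> 0" "\<xi> \<noteq> 0"
  shows "card {(y, \<eta>). y \<noteq> 0 \<and> \<eta> \<noteq> 0 \<and> mat_class (twisted_mat \<sigma> y \<eta>) = mat_class (twisted_mat \<sigma> x \<xi>)}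
    = (CARD('a) - 1) ^ 2" (is "card ?S = _")
proof -
  interpret field_automorphism \<sigma> using aut by unfold_locales
  let ?U = "UNIV - {0 :: 'a}"
  let ?h = "\<lambda>(a, b). (a *s x, b *s \<xi>)"
  have "?S \<subseteq> ?h ` (?U \<times> ?U)"
  proof
    fix z assume "z \<in> ?S"
    then obtain y \<eta> where z: "z = (y, \<eta>)" and y: "y \<noteq> 0" "\<eta> \<noteq> 0"
      "mat_class (twisted_mat \<sigma> y \<eta>) = mat_class (twisted_mat \<sigma> x \<xi>)" by blast
    obtain a b where "a \<noteq> 0" "b \<noteq> 0" "y = a *s x" "\<eta> = b *s \<xi>"
      using twisted_mat_class_eqD[OF aut y] .
    then show "z \<in> ?h ` (?U \<times> ?U)" unfolding z by (intro image_eqI[of _ _ "(a, b)"]) simp_all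
  qed
  moreover have "?h ` (?U \<times> ?U) \<subseteq> ?S"
  proof (rule image_subsetI)
    fix z assume "z \<in> ?U \<times> ?U"
    then obtain a b where z: "z = (a, b)" and ab: "a \<noteq> 0" "b \<noteq> 0" by blast
    have "twisted_mat \<sigma> (a *s x) (b *s \<xi>) = map_matrix ((*) (\<sigma> a * b)) (twisted_mat \<sigma> x \<xi>)"
      by (simp add: vec_eq_iff twisted_mat_nth aut_mult map_matrix_def)
    moreover have "\<sigma> a * b \<noteq> 0" using ab by (simp add: aut_eq_0)
    ultimately have "mat_class (twisted_mat \<sigma> (a *s x) (b *s \<xi>)) = mat_class (twisted_mat \<sigma> x \<xi>)"
      by (metis mat_class_scale)
    then show "?h z \<in> ?S" using ab nz by (simp add: z)
  qed
  ultimately have S: "?S = ?h ` (?U \<times> ?U)" by (rule subset_antisym)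
  have "inj_on ?h (?U \<times> ?U)" using nz by (auto simp: inj_on_def)
  then have "card ?S = card (?U \<times> ?U)" unfolding S by (rule card_image)
  then show ?thesis by (simp add: card_cartesian_product card_Diff_singleton power2_eq_square)
qed

lemma hamming_weight_codeword:
  "hamming_weight (codeword Xs M) = card {i. i < length Xs \<and> trace (Xs ! i ** M) \<noteq> 0}"
  unfolding hamming_weight_def codeword_def by (rule arg_cong[where f = card]) auto

text \<open>The moved pairs are partitioned by the position of the representative proportional to
  their twisted matrix. Positions with a nonzero entry contribute full fibres of equal size, the
  others nothing.\<close>

lemma card_moved_pairs_weight:
  fixes Xs :: "('a::{field,finite}^'n^'n) list"
  assumes aut: "field_aut \<sigma>" and Xs: "representatives (twisted_image \<sigma>) Xs"
  shows "card (semilinear_map.moved_pairs (twisted_map \<sigma> M)) =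
    (CARD('a) - 1) ^ 2 * hamming_weight (codeword Xs M)"
proof -
  interpret semilinear_map \<sigma> "twisted_map \<sigma> M" using aut by (rule semilinear_twisted_map)
  have dist: "distinct (map mat_class Xs)" and im: "mat_class ` set Xs = twisted_image \<sigma>"
    using Xs by (auto simp: representatives_def)
  define I where "I = {i. i < length Xs \<and> trace (Xs ! i ** M) \<noteq> 0}"
  define F where "F X = {(y, \<eta>). y \<noteq> 0 \<and> \<eta> \<noteq> 0 \<and> mat_class (twisted_mat \<sigma> y \<eta>) = mat_class X}"
    for X :: "'a^'n^'n"
  have rep: "\<exists>x \<xi>. x \<noteq> 0 \<and> \<xi> \<noteq> 0 \<and> dotp \<xi> x = 0 \<and> mat_class (twisted_mat \<sigma> x \<xi>) = mat_class X"
    if X: "X \<in> set Xs" for X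
  proof -
    have "mat_class X \<in> twisted_image \<sigma>" using im X by blast
    then obtain x \<xi> where "x \<noteq> 0" "\<xi> \<noteq> 0" "dotp \<xi> x = 0"
        "mat_class X = twisted_embedding \<sigma> (col_class x, row_class \<xi>)"
      by (auto simp: twisted_image_def flag_points_eq)
    then show ?thesis using twisted_embedding_class[OF aut] by metis
  qed
  have card_F: "card (F X) = (CARD('a) - 1) ^ 2" if X: "X \<in> set Xs" for X
  proof -
    obtain x \<xi> where x: "x \<noteq> 0" "\<xi> \<noteq> 0" "mat_class (twisted_mat \<sigma> x \<xi>) = mat_class X"
      using rep[OF X] by blast
    show ?thesis using card_twisted_mat_fibre[OF aut x(1,2)] unfolding F_def x(3) .
  qed
  have "moved_pairs = (\<Union>i\<in>I. F (Xs ! i))"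
  proof (intro equalityI subsetI)
    fix z assume "z \<in> moved_pairs"
    then obtain x \<xi> where z: "z = (x, \<xi>)" "dotp \<xi> x = 0" and tr: "trace (twisted_mat \<sigma> x \<xi> ** M) \<noteq> 0"
      by (auto simp: moved_pairs_def trace_twisted_mat)
    have nz: "x \<noteq> 0" "\<xi> \<noteq> 0" using tr by (auto simp: trace_twisted_mat f_0)
    then have "(col_class x, row_class \<xi>) \<in> flag_points" using z by (auto simp: flag_points_eq)
    then have "mat_class (twisted_mat \<sigma> x \<xi>) \<in> twisted_image \<sigma>"
      unfolding twisted_image_def twisted_embedding_class[OF aut nz, symmetric] by (rule imageI)
    then obtain i where i: "i < length Xs" "mat_class (twisted_mat \<sigma> x \<xi>) = mat_class (Xs ! i)"
      unfolding im[symmetric] by (metis imageE in_set_conv_nth)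
    then have "i \<in> I" using tr trace_eq_0_mat_class[OF i(2)] by (simp add: I_def)
    moreover have "z \<in> F (Xs ! i)" using z nz i by (simp add: F_def)
    ultimately show "z \<in> (\<Union>i\<in>I. F (Xs ! i))" by (rule UN_I)
  next
    fix z assume "z \<in> (\<Union>i\<in>I. F (Xs ! i))"
    then obtain i y \<eta> where z: "z = (y, \<eta>)" and i: "i < length Xs" "trace (Xs ! i ** M) \<noteq> 0"
      and y: "y \<noteq> 0" "\<eta> \<noteq> 0" and eq: "mat_class (twisted_mat \<sigma> y \<eta>) = mat_class (Xs ! i)"
      by (auto simp: I_def F_def)
    obtain x \<xi> where x: "x \<noteq> 0" "\<xi> \<noteq> 0" "dotp \<xi> x = 0"
        "mat_class (twisted_mat \<sigma> x \<xi>) = mat_class (Xs ! i)"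
      using rep[of "Xs ! i"] i(1) by auto
    \<comment> \<open>The fibre \<open>F\<close> does not mention incidence; it is inherited from
      flag coordinates of the representative, since \<open>y\<close> and \<open>\<eta>\<close> are
      multiples of them.\<close>
    obtain a b where "y = a *s x" "\<eta> = b *s \<xi>"
      using twisted_mat_class_eqD[OF aut y eq[folded x(4)]] by blast
    then have "dotp \<eta> y = 0" using x(3) by simp
    moreover have "dotp \<eta> (twisted_map \<sigma> M y) \<noteq> 0"
      using i(2) trace_eq_0_mat_class[OF eq] by (simp add: trace_twisted_mat)
    ultimately show "z \<in> moved_pairs" by (simp add: z moved_pairs_def)
  qed
  moreover have "F (Xs ! i) \<inter> F (Xs ! j) = {}" if "i \<in> I" "j \<in> I" "i \<noteq> j" for i j
    using dist that by (auto simp: F_def I_def distinct_conv_nth)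
  ultimately have "card moved_pairs = (\<Sum>i\<in>I. card (F (Xs ! i)))"
    by (simp add: card_UN_disjoint I_def)
  also have "\<dots> = (\<Sum>i\<in>I. (CARD('a) - 1) ^ 2)" by (intro sum.cong refl card_F) (simp add: I_def)
  also have "\<dots> = (CARD('a) - 1) ^ 2 * card I" by simp
  finally show ?thesis by (simp add: hamming_weight_codeword I_def)
qed

section \<open>Low weight codewords\<close>

theorem theorem3p18:
  fixes n :: nat
    and \<sigma> :: "'a::{field,finite} \<Rightarrow> 'a"
    and Xs :: "('a^'n^'n) list"
    and M :: "'a^'n^'n"
  assumes "CARD('n) = n + 1" and "n \<ge> 2"
    and "field_aut \<sigma>" and "\<sigma> \<noteq> id"
    and "n > 2 \<or> \<sigma> \<circ> \<sigma> \<noteq> id"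
    and "representatives (twisted_image \<sigma>) Xs"
    and "M \<noteq> 0"
  shows "(min_weight_codeword (proj_code Xs) (codeword Xs M) \<longleftrightarrow>
            quasi_singular (twisted_preimage \<sigma> (pg_mat (mat_perp M))) \<and>
            \<not> singular (twisted_preimage \<sigma> (pg_mat (mat_perp M)))) \<and>
         (second_weight_codeword (proj_code Xs) (codeword Xs M) \<longleftrightarrow>
            singular (twisted_preimage \<sigma> (pg_mat (mat_perp M))))"
proof -

  \<comment> \<open>Possible numbers of eigenvectors\<close>
  note aut = assms(3)
  note semi = semilinear_twisted_map[OF aut]
  define q where "q = CARD('a)"
  have q2: "q \<ge> 2" unfolding q_def by (rule field_card_ge2)
  \<comment> \<open>The eigenvector counts of the rank one maps: \<open>lo\<close> when
    \<open>dotp \<beta> u = 0\<close>, \<open>hi\<close> otherwise. All other nonzero matrices stay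
    below \<open>lo\<close>.\<close>
  define lo where "lo = q ^ n"
  define hi where "hi = q ^ n + (q - 1)"
  define g where "g N = card (semilinear_map.eigenvectors (twisted_map \<sigma> N))" for N :: "'a^'n^'n"
  define w where "w N = hamming_weight (codeword Xs N)" for N
  define Z where "Z N = (twisted_preimage \<sigma> (pg_mat (mat_perp N)) :: ('a, 'n) flag set)" for N :: "'a^'n^'n"
  define form where "form N u \<beta> \<longleftrightarrow> u \<noteq> 0 \<and> \<beta> \<noteq> 0 \<and> (\<forall>x. twisted_map \<sigma> N x = \<sigma> (dotp \<beta> x) *s u)"
    for N :: "'a^'n^'n" and u \<beta>
  have g_form: "g N = (if dotp \<beta> u = 0 then lo else hi)" if "form N u \<beta>" for N u \<beta>
    using semilinear_map.card_eigenvectors_rank_one[OF semi, of u \<beta> N] that assms(1)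
    by (simp add: form_def g_def lo_def hi_def q_def)
  have tri: "g N < lo \<or> (\<exists>u \<beta>. form N u \<beta>)" if N: "N \<noteq> 0" for N
  proof -
    obtain x where "twisted_map \<sigma> N x \<noteq> 0" using twisted_map_eq_0[OF aut] N by blast
    then show ?thesis
      using semilinear_map.card_eigenvectors_trichotomy[OF semi, of N x] assms(1,2,4,5)
      by (auto simp: g_def lo_def form_def q_def)
  qed
  have ex: "\<exists>N. form N u \<beta>" if "u \<noteq> 0" "\<beta> \<noteq> 0" for u \<beta> :: "'a^'n"
    using that twisted_map_rank_one[OF aut] unfolding form_def by blast
  have form_nz: "N \<noteq> 0" if form: "form N u \<beta>" for N u \<beta>
  proof
    assume "N = 0"
    have "\<beta> \<noteq> 0" using form by (simp add: form_def)
    then obtain x where x: "dotp \<beta> x = 1" by (rule dotp_separates)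
    have "twisted_map \<sigma> N x = 0" unfolding \<open>N = 0\<close> by (simp add: vec_eq_iff twisted_map_nth)
    then show False using form x aut by (simp add: form_def field_aut_def)
  qed
  have "lo < hi" using q2 by (simp add: lo_def hi_def)
  have "hi < q ^ (n + 1)"
  proof -
    have "q ^ n \<ge> q" using self_le_power[of q n] q2 assms(2) by simp
    then have "hi < 2 * q ^ n" using q2 unfolding hi_def by linarith
    also have "\<dots> \<le> q * q ^ n" using q2 by (rule mult_le_mono1)
    finally show ?thesis by simp
  qed
  have g_cases: "g N = hi \<or> g N \<le> lo" if "N \<noteq> 0" for N
    using tri[OF that] g_form by fastforce
  have g_le: "g N \<le> q ^ (n + 1)" for N
    unfolding g_def q_def assms(1)[symmetric] CARD_vec[symmetric] by (rule card_mono) simp_all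

  \<comment> \<open>Weight as a decreasing function of the number of eigenvectors\<close>
  define D where "D = q ^ n - q ^ (n - 1)"
  have D: "D > 0" unfolding D_def using q2 assms(2) by simp
  have weight: "(q - 1) ^ 2 * w N = D * (q ^ (n + 1) - g N)" for N
    using card_moved_pairs_weight[OF aut assms(6), of N] semilinear_map.card_moved_pairs[OF semi, of N] assms(1)
    by (simp add: w_def D_def q_def g_def)
  have w_le: "w N \<le> w N' \<longleftrightarrow> g N' \<le> g N" for N N'
  proof -
    have "w N \<le> w N' \<longleftrightarrow> (q - 1) ^ 2 * w N \<le> (q - 1) ^ 2 * w N'" using q2 by simp
    also have "\<dots> \<longleftrightarrow> q ^ (n + 1) - g N \<le> q ^ (n + 1) - g N'" unfolding weight using D by simp
    \<comment> \<open>The bound \<open>g_le\<close> keeps the natural subtraction from truncating,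
      so the order is reversed faithfully.\<close>
    also have "\<dots> \<longleftrightarrow> g N' \<le> g N" using g_le[of N] g_le[of N'] by linarith
    finally show ?thesis .
  qed
  \<comment> \<open>Weight zero would make all \<open>q ^ (n + 1)\<close> vectors eigenvectors,
    which \<open>hi < q ^ (n + 1)\<close> rules out for a nonzero matrix.\<close>
  have w_0: "w N = 0 \<longleftrightarrow> N = 0" for N
  proof
    assume "w N = 0"
    then have "g N = q ^ (n + 1)" using weight[of N] D g_le[of N] by simp
    then show "N = 0" using g_cases[of N] \<open>hi < q ^ (n + 1)\<close> \<open>lo < hi\<close> by linarith
  qed (simp add: w_def hamming_weight_codeword trace_def)
  obtain j :: 'n where True by blast
  obtain k :: 'n where k: "k \<noteq> j"
  proof -
    have "\<not> UNIV \<subseteq> {j}" using card_mono[of "{j}" UNIV] assms(1,2) by auto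
    then show ?thesis using that by blast
  qed
  have axis_nth: "axis i 1 $ l = (if l = i then 1 else 0 :: 'a)" for i l :: 'n by (simp add: axis_def)
  have ax: "axis i 1 \<noteq> (0 :: 'a^'n)" for i by (simp add: axis_eq_0_iff)
  \<comment> \<open>A unit vector pairs to 1 with itself and to 0 with another one, so both
    \<open>hi\<close> and \<open>lo\<close> are attained.\<close>
  obtain N1 where N1: "form N1 (axis j 1) (axis j 1)" using ex ax by blast
  obtain N2 where N2: "form N2 (axis j 1) (axis k 1)" using ex ax by blast
  have gN1: "g N1 = hi" "N1 \<noteq> 0" using g_form[OF N1] form_nz[OF N1] by (simp_all add: axis_nth)
  have gN2: "g N2 = lo" "N2 \<noteq> 0" using g_form[OF N2] form_nz[OF N2] k by (simp_all add: axis_nth)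

  \<comment> \<open>The two lowest weights\<close>
  have min_iff: "min_weight_codeword (proj_code Xs) (codeword Xs N) \<longleftrightarrow> N \<noteq> 0 \<and> g N = hi" for N
  proof -
    have "min_weight_codeword (proj_code Xs) (codeword Xs N) \<longleftrightarrow>
        N \<noteq> 0 \<and> (\<forall>N'. N' \<noteq> 0 \<longrightarrow> g N' \<le> g N)"
      unfolding min_weight_codeword_def proj_code_def ball_simps
      by (simp flip: w_def add: w_0 w_le)
    also have "\<dots> \<longleftrightarrow> N \<noteq> 0 \<and> g N = hi"
      using g_cases gN1 \<open>lo < hi\<close> by (metis le_antisym le_trans nat_less_le order_refl)
    finally show ?thesis .
  qed
  have second_iff: "second_weight_codeword (proj_code Xs) (codeword Xs N) \<longleftrightarrow> N \<noteq> 0 \<and> g N = lo" for N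
  proof -
    have "second_weight_codeword (proj_code Xs) (codeword Xs N) \<longleftrightarrow>
        N \<noteq> 0 \<and> g N \<noteq> hi \<and> (\<forall>N'. N' \<noteq> 0 \<and> g N' \<noteq> hi \<longrightarrow> g N' \<le> g N)"
      unfolding second_weight_codeword_def proj_code_def ball_simps
      by (auto simp flip: w_def simp add: w_0 w_le min_iff[unfolded proj_code_def])
    \<comment> \<open>Once \<open>hi\<close> is excluded, \<open>lo\<close> is the largest remaining
      count, and \<open>N2\<close> attains it.\<close>
    also have "\<dots> \<longleftrightarrow> N \<noteq> 0 \<and> g N = lo"
      using g_cases gN2 \<open>lo < hi\<close> by (metis le_antisym nat_less_le)
    finally show ?thesis .
  qed

  \<comment> \<open>Eigenvector counts read off from the geometric hyperplane\<close>
  have Z_form: "Z N = qs_hyperplane (col_class u) (row_class \<beta>)" if "form N u \<beta>" for N u \<beta>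
    unfolding Z_def using that by (intro twisted_preimage_rank_one[OF aut]) (auto simp: form_def)
  \<comment> \<open>The moved pairs, hence the weight and the eigenvector count, depend only on the
    geometric hyperplane. A matrix whose hyperplane is quasi-singular can thus be compared with a
    rank one matrix of the same hyperplane, without first showing that it has rank one
    itself.\<close>
  have g_Z: "g N = g N'" if "Z N = Z N'" for N N'
  proof -
    have "semilinear_map.moved_pairs (twisted_map \<sigma> N) =
        {(x, \<xi>). x \<noteq> 0 \<and> \<xi> \<noteq> 0 \<and> dotp \<xi> x = 0 \<and> (col_class x, row_class \<xi>) \<notin> Z N}" for N
    proof -
      have "dotp \<xi> x = 0 \<and> dotp \<xi> (twisted_map \<sigma> N x) \<noteq> 0 \<longleftrightarrow>
          x \<noteq> 0 \<and> \<xi> \<noteq> 0 \<and> dotp \<xi> x = 0 \<and> (col_class x, row_class \<xi>) \<notin> Z N" for x \<xi>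
      proof (cases "x = 0 \<or> \<xi> = 0")
        case True
        then show ?thesis by (auto simp: semilinear_map.f_0[OF semi])
      next
        case False
        then show ?thesis using twisted_preimage_perp[OF aut] by (auto simp: Z_def)
      qed
      then show ?thesis unfolding semilinear_map.moved_pairs_def[OF semi] by simp
    qed
    then have "(q - 1) ^ 2 * w N = (q - 1) ^ 2 * w N'"
      using card_moved_pairs_weight[OF aut assms(6), of N] card_moved_pairs_weight[OF aut assms(6), of N'] that
      unfolding w_def q_def by simp
    then have "w N = w N'" using q2 by simp
    then show ?thesis using w_le by (metis le_antisym order_refl)
  qed
  have qs_form: "\<exists>u \<beta> N'. p = col_class u \<and> A = row_class \<beta> \<and> form N' u \<beta> \<and> g N = g N'"
    if "p \<in> pg_points" "A \<in> pg_hyperplanes" "Z N = qs_hyperplane p A" for p A N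
  proof -
    obtain u \<beta> where "u \<noteq> 0" "\<beta> \<noteq> 0" and pA: "p = col_class u" "A = row_class \<beta>"
      using \<open>p \<in> pg_points\<close> \<open>A \<in> pg_hyperplanes\<close> unfolding points_col_class hyperplane_row_class by blast
    then obtain N' where N': "form N' u \<beta>" using ex by blast
    then have "Z N = Z N'" using Z_form that(3) pA by simp
    then show ?thesis using pA N' g_Z by blast
  qed
  have form_pA: "col_class u \<in> pg_points" "row_class \<beta> \<in> pg_hyperplanes" if "form N u \<beta>" for N u \<beta>
    using that by (auto simp: form_def points_col_class hyperplane_row_class)
  have sing: "singular (Z N) \<longleftrightarrow> g N = lo" if N: "N \<noteq> 0" for N
  proof
    assume "singular (Z N)"
    then obtain p A where pA: "p \<in> pg_points" "A \<in> pg_hyperplanes" "p \<subseteq> A" "Z N = qs_hyperplane p A"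
      unfolding singular_def by blast
    then obtain u \<beta> N' where "p = col_class u" "A = row_class \<beta>" "form N' u \<beta>" "g N = g N'"
      using qs_form by blast
    then show "g N = lo" using g_form pA(3) by (simp add: col_subset_row)
  next
    assume lo: "g N = lo"
    \<comment> \<open>The count \<open>lo\<close> excludes the strict alternative of
      \<open>tri\<close>, leaving rank one; \<open>lo < hi\<close> then forces
      \<open>dotp \<beta> u = 0\<close>.\<close>
    then obtain u \<beta> where f: "form N u \<beta>" using tri[OF N] by auto
    then have "dotp \<beta> u = 0" using g_form[OF f] lo \<open>lo < hi\<close> by (simp split: if_splits)
    then show "singular (Z N)"
      unfolding singular_def using form_pA[OF f] Z_form[OF f] col_subset_row by blast
  qed
  have qs: "quasi_singular (Z N) \<longleftrightarrow> g N = lo \<or> g N = hi" if N: "N \<noteq> 0" for N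
  proof
    assume "quasi_singular (Z N)"
    then obtain p A where pA: "p \<in> pg_points" "A \<in> pg_hyperplanes" "Z N = qs_hyperplane p A"
      unfolding quasi_singular_def by blast
    then obtain u \<beta> N' where "form N' u \<beta>" "g N = g N'" using qs_form by blast
    then show "g N = lo \<or> g N = hi" using g_form[of N' u \<beta>] by simp
  next
    assume "g N = lo \<or> g N = hi"
    then obtain u \<beta> where f: "form N u \<beta>" using tri[OF N] \<open>lo < hi\<close> by auto
    show "quasi_singular (Z N)"
      unfolding quasi_singular_def using form_pA[OF f] Z_form[OF f] by blast
  qed
  show ?thesis
    using assms(7) \<open>lo < hi\<close> min_iff[of M] second_iff[of M] sing[of M] qs[of M] unfolding Z_def by auto
qed

end
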